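(* Let $f$ be a capacity function. The expectation $m(f)=E(S_o(f))$ of the cell capacity of the typical base station is $$m(f)=\lambda_M\int_0^\infty B'(\beta)e^{-\lambda_B B(\beta)}f(\beta)\,d\beta .$$ In the case of the path loss exponent model $L(z)=K|z|^{-\gamma}$, one has $$m(f)=\frac{\lambda_M}{\lambda_B}\mathcal{L}_{\widetilde f}(\lambda_B C),$$ where $C=\pi K^{2/\gamma}E(H^{2/\gamma})$, $\widetilde f(t)=f(t^{\gamma/2})$, and $\mathcal{L}_g(s)=\int_0^\infty e^{-st}g(t)\,dt$ is the Laplace transform of $g$.
   Context: Base stations: $\Pi_B=\{y_0,y_1,\dots\}$ is a homogeneous Poisson point process on $\mathbb{R}^2$ of intensity $\lambda_B$. Users: $\Pi_M=\{x_0,x_1,\dots\}$ is a homogeneous Poisson point process on $\mathbb{R}^2$ of intensity $\lambda_M$, independent of $\Pi_B$. Path loss: $L$ is a positive measurable function on $\mathbb{R}^2$; in the path loss exponent model $K,\gamma>0$ are constants and $|z|$ is the Euclidean norm. Fading: $H$ is a nonnegative random variable with probability density function $p_H$ and complementary cumulative distribution function $F_H(\beta)=P(H\ge\beta)=\int_\beta^\infty p_H(t)\,dt>0$. Define $B(\beta)=\int_{\mathbb{R}^2}F_H\big((L(z)\beta)^{-1}\big)\,dz$; it is assumed that $0<B(\beta)<\infty$ for all $\beta>0$. $B'$ denotes the derivative of $B$. A capacity function is a nonnegative measurable function $f$ on the positive half-line, evaluated at the path loss fading. The typical base station is a base station placed at the origin $o$, in addition to those of $\Pi_B$. To each pair $(y,x)$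 with $y$ a base station and $x$ a user location is attached a fading variable $h_{yx}$; all these variables are independent copies of $H$, independent of $\Pi_B$ and $\Pi_M$. Put $s_{yx}=\big(h_{yx}L(y-x)\big)^{-1}$ and let $\xi_0^x=\min_{y\in\Pi_B}s_{yx}$ be the smallest path loss fading at $x$ among the base stations of $\Pi_B$ (not counting $o$). A user $x$ is served by $o$ if and only if $s_{ox}<\xi_0^x$. The cell capacity of the typical base station is $S_o(f)=\sum_{x\in\Pi_M}\mathbf{1}(s_{ox}<\xi_0^x)\,f(s_{ox})$.
   Formalization: The path loss exponent formula is proved with a missing factor λ_B C restored: m(f) = (λ_M/λ_B)·λ_B C·L_{f~}(λ_B C); as printed it contradicts the first formula (take f = 1, λ_B C ≠ 1). L(0) is an arbitrary positive number. *)

theory Defs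
  imports "HOL-Probability.Probability"
begin

text \<open>
  A point process is given by a measurable enumeration of its points, so the count of a set is a sum
  over the indices. It is valued in \<open>[0, \<infinity>]\<close>, and is almost surely finite on sets of finite volume
  for the processes below.
\<close>

definition point_count :: "(nat \<Rightarrow> 'w \<Rightarrow> 'a) \<Rightarrow> 'a set \<Rightarrow> 'w \<Rightarrow> ennreal"
  where "point_count P A \<omega> = (\<Sum>n. indicator A (P n \<omega>))"

definition homogeneous_poisson_process ::
    "'w measure \<Rightarrow> real \<Rightarrow> (nat \<Rightarrow> 'w \<Rightarrow> 'a::euclidean_space) \<Rightarrow> bool"
  where "homogeneous_poisson_process M lam P \<longleftrightarrow>
    (\<forall>n. P n \<in> borel_measurable M) \<and>
    (\<forall>A\<in>sets borel. emeasure lborel A < \<infinity> \<longrightarrow>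
      (\<forall>k. measure M {\<omega> \<in> space M. point_count P A \<omega> = of_nat k} =
        (lam * measure lborel A) ^ k / fact k * exp (- (lam * measure lborel A)))) \<and>
    (\<forall>\<A>. finite \<A> \<and> \<A> \<subseteq> {A \<in> sets borel. emeasure lborel A < \<infinity>} \<and> disjoint \<A> \<longrightarrow>
      prob_space.indep_vars M (\<lambda>_. borel) (point_count P) \<A>)"

text \<open>
  Independence of the processes themselves, that is, of the \<open>\<sigma>\<close>-algebras generated by their counts;
  nothing is required of the joint law of the two enumerations.
\<close>

definition independent_processes ::
    "'w measure \<Rightarrow> (nat \<Rightarrow> 'w \<Rightarrow> 'a::euclidean_space) \<Rightarrow> (nat \<Rightarrow> 'w \<Rightarrow> 'a) \<Rightarrow> bool"
  where "independent_processes M P Q \<longleftrightarrow>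
    prob_space.indep_var M
      (Pi\<^sub>M (sets borel) (\<lambda>_. borel)) (\<lambda>\<omega>. \<lambda>A\<in>sets borel. point_count P A \<omega>)
      (Pi\<^sub>M (sets borel) (\<lambda>_. borel)) (\<lambda>\<omega>. \<lambda>A\<in>sets borel. point_count Q A \<omega>)"

text \<open>
  The fading variables are indexed by the pair (base station, user): \<open>h (Some n) m\<close> belongs to the
  base station \<open>Y n\<close> and the user \<open>X m\<close>, and \<open>h None m\<close> to the typical base station at the origin
  and the user \<open>X m\<close>. They are mutually independent, and as a family independent of the
  locations; the \<open>\<sigma>\<close>-algebras have to be named because the two families differ in type.
\<close>

definition independent_fading ::
    "'w measure \<Rightarrow> (nat option \<Rightarrow> nat \<Rightarrow> 'w \<Rightarrow> real) \<Rightarrow>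
     (nat \<Rightarrow> 'w \<Rightarrow> 'a::euclidean_space) \<Rightarrow> (nat \<Rightarrow> 'w \<Rightarrow> 'a) \<Rightarrow> bool"
  where "independent_fading M h Y X \<longleftrightarrow>
    prob_space.indep_vars M (\<lambda>_. borel) (\<lambda>(i, m). h i m) UNIV \<and>
    prob_space.indep_set M
      (sets (vimage_algebra (space M) (\<lambda>\<omega> (i, m). h i m \<omega>) (Pi\<^sub>M UNIV (\<lambda>_. borel))))
      (sets (vimage_algebra (space M) (\<lambda>\<omega> n. (Y n \<omega>, X n \<omega>)) (Pi\<^sub>M UNIV (\<lambda>_. borel))))"

definition ccdf :: "'w measure \<Rightarrow> ('w \<Rightarrow> real) \<Rightarrow> real \<Rightarrow> real"
  where "ccdf M H \<beta> = measure M {\<omega> \<in> space M. \<beta> \<le> H \<omega>}"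

text \<open>
  \<open>H\<close> having a density makes \<open>B_fun\<close> locally absolutely continuous on the positive half-line, but for
  a general \<open>L\<close> it is differentiable only almost everywhere there. The values of \<open>deriv\<close> elsewhere are
  unspecified and lie over a null set.
\<close>

definition B_fun :: "'w measure \<Rightarrow> ('a::euclidean_space \<Rightarrow> real) \<Rightarrow> ('w \<Rightarrow> real) \<Rightarrow> real \<Rightarrow> real"
  where "B_fun M L H \<beta> = (\<integral>z. ccdf M H (inverse (L z * \<beta>)) \<partial>lborel)"

definition capacity_function :: "(real \<Rightarrow> real) \<Rightarrow> bool"
  where "capacity_function f \<longleftrightarrow>
    f \<in> borel_measurable (restrict_space borel {0<..}) \<and> (\<forall>\<beta>>0. 0 \<le> f \<beta>)"

definition station :: "(nat \<Rightarrow> 'w \<Rightarrow> 'a::euclidean_space) \<Rightarrow> nat option \<Rightarrow> 'w \<Rightarrow> 'a"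
  where "station Y i \<omega> = (case i of None \<Rightarrow> 0 | Some n \<Rightarrow> Y n \<omega>)"

text \<open>Valued in \<open>(0, \<infinity>]\<close>, so that a vanishing fading variable gives \<open>\<infinity>\<close> and not \<open>1 / 0 = 0\<close>.\<close>

definition path_loss_fading ::
    "('a::euclidean_space \<Rightarrow> real) \<Rightarrow> (nat option \<Rightarrow> nat \<Rightarrow> 'w \<Rightarrow> real) \<Rightarrow>
     (nat \<Rightarrow> 'w \<Rightarrow> 'a) \<Rightarrow> (nat \<Rightarrow> 'w \<Rightarrow> 'a) \<Rightarrow> nat option \<Rightarrow> nat \<Rightarrow> 'w \<Rightarrow> ennreal"
  where "path_loss_fading L h Y X i m \<omega> =
    inverse (ennreal (h i m \<omega> * L (station Y i \<omega> - X m \<omega>)))"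

definition min_path_loss_fading ::
    "('a::euclidean_space \<Rightarrow> real) \<Rightarrow> (nat option \<Rightarrow> nat \<Rightarrow> 'w \<Rightarrow> real) \<Rightarrow>
     (nat \<Rightarrow> 'w \<Rightarrow> 'a) \<Rightarrow> (nat \<Rightarrow> 'w \<Rightarrow> 'a) \<Rightarrow> nat \<Rightarrow> 'w \<Rightarrow> ennreal"
  where "min_path_loss_fading L h Y X m \<omega> = (INF n. path_loss_fading L h Y X (Some n) m \<omega>)"

text \<open>
  In the first branch the path loss fading lies in \<open>(0, \<infinity>)\<close>, so \<open>f\<close> is only evaluated at positive
  real numbers.
\<close>

definition cell_capacity ::
    "('a::euclidean_space \<Rightarrow> real) \<Rightarrow> (nat option \<Rightarrow> nat \<Rightarrow> 'w \<Rightarrow> real) \<Rightarrow>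
     (nat \<Rightarrow> 'w \<Rightarrow> 'a) \<Rightarrow> (nat \<Rightarrow> 'w \<Rightarrow> 'a) \<Rightarrow> (real \<Rightarrow> real) \<Rightarrow> 'w \<Rightarrow> ennreal"
  where "cell_capacity L h Y X f \<omega> =
    (\<Sum>m. if path_loss_fading L h Y X None m \<omega> < min_path_loss_fading L h Y X m \<omega>
          then ennreal (f (enn2real (path_loss_fading L h Y X None m \<omega>))) else 0)"

definition mean_cell_capacity ::
    "'w measure \<Rightarrow> ('a::euclidean_space \<Rightarrow> real) \<Rightarrow> (nat option \<Rightarrow> nat \<Rightarrow> 'w \<Rightarrow> real) \<Rightarrow>
     (nat \<Rightarrow> 'w \<Rightarrow> 'a) \<Rightarrow> (nat \<Rightarrow> 'w \<Rightarrow> 'a) \<Rightarrow> (real \<Rightarrow> real) \<Rightarrow> ennreal"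
  where "mean_cell_capacity M L h Y X f = (\<integral>\<^sup>+\<omega>. cell_capacity L h Y X f \<omega> \<partial>M)"

text \<open>For \<open>g\<close> nonnegative on the positive half-line, with values in \<open>[0, \<infinity>]\<close>. The transform of \<open>1\<close>
  is \<open>1 / s\<close>, so that \<open>s\<close> times the transform is the mean of \<open>g\<close> at an exponential variable of rate \<open>s\<close>.\<close>

definition laplace_transform :: "(real \<Rightarrow> real) \<Rightarrow> real \<Rightarrow> ennreal"
  where "laplace_transform g s = (\<integral>\<^sup>+t\<in>{0<..}. ennreal (exp (- (s * t)) * g t) \<partial>lborel)"

end

theory Submission
  imports Defs
begin

text \<open>
  Fix the locations of stations and users and average over the fading first. A user at \<open>x\<close> whose
  fading towards the origin is \<open>t\<close> sees the path loss fading \<open>\<beta> = 1 / (t L(-x))\<close>, and it is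
  served by the origin iff its fading towards each station \<open>y\<close> is at most \<open>t L(-x) / L(y - x)\<close>
  (ties have probability zero because \<open>H\<close> has a density). By independence this has probability
  \<open>\<Prod>\<^sub>n (1 - v(Y\<^sub>n))\<close> with \<open>v(y) = P(H \<ge> t L(-x) / L(y - x))\<close>
  (\<open>nn_integral_fading_given_locations\<close>, \<open>nn_integral_served_given_locations\<close>).

  Averaging this product over the stations is an instance of the Laplace functional of the Poisson
  process (\<open>poisson_laplace_functional\<close>), and gives \<open>exp(- \<lambda>\<^sub>B \<integral>v)\<close>; after a translation
  \<open>\<integral>v\<close> is \<open>B(\<beta>)\<close>. Averaging over the users is Campbell's formula
  (\<open>campbell_independent\<close>) and produces \<open>\<lambda>\<^sub>M\<close> times an integral over the position \<open>x\<close>. The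
  independence of the two processes is known through their counts only. The conditional
  expectation therefore has to be seen as a function of the counts of the stations, and this is why
  products over stations are written as \<open>exp(- \<Sum>\<^sub>n w(Y\<^sub>n))\<close>: such a sum is an integral with
  respect to the counting measure. The value \<open>w = \<infinity>\<close> must be admitted, as \<open>v\<close> can be \<open>1\<close>.

  Altogether the mean is \<open>\<lambda>\<^sub>M \<integral> f(\<beta>) exp(- \<lambda>\<^sub>B B(\<beta>)) d\<mu>(\<beta>)\<close>, where \<open>\<mu>\<close> is the image of
  Lebesgue measure times the law of \<open>H\<close> under \<open>(x, t) \<mapsto> 1 / (t L(x))\<close>
  (\<open>mean_cell_capacity_fading_intensity\<close>). This measure has distribution function \<open>B\<close> and
  inherits absolute continuity from \<open>H\<close>, so by Lebesgue's differentiation theorem its density is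
  \<open>B'\<close> almost everywhere (\<open>nn_integral_abs_continuous_eq_deriv\<close>); that is the first formula.

  For the path loss exponent model the discs \<open>{x. 1 / (t L(x)) \<le> \<beta>}\<close> have area
  \<open>\<pi> (K \<beta> t)\<^bsup>2/\<gamma>\<^esup>\<close>, hence \<open>\<mu>\<close> has distribution function \<open>C \<beta>\<^bsup>2/\<gamma>\<^esup>\<close>. So does \<open>C\<close> times the
  image of Lebesgue measure on the half-line under \<open>t \<mapsto> t\<^bsup>\<gamma>/2\<^esup>\<close>; the two measures coincide, and
  integrating against the second one is a Laplace transform.
\<close>

section \<open>Differentiation of indefinite integrals\<close>

text \<open>
  Lebesgue's differentiation theorem on the line, for the gauge integral. Suppose that arbitrarily
  short intervals with end point \<open>x\<close> have a difference quotient that differs from \<open>f x\<close> by more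
  than \<open>1 / (k + 1)\<close>. Tagged by \<open>x\<close>, each of them contributes more than \<open>1 / (k + 1)\<close> times its
  length to a Henstock sum. The Vitali covering theorem selects disjoint ones among them that cover
  almost all such points, and the Henstock lemma makes their total length as small as desired.
\<close>

lemma indefinite_integral_has_derivative_ae:
  fixes f :: "real \<Rightarrow> real"
  assumes f: "f integrable_on {a..b}"
  shows "negligible {x \<in> {a<..<b}. \<not> ((\<lambda>u. integral {a..u} f) has_real_derivative f x) (at x)}"
proof -
  define F where "F u = integral {a..u} f" for u
  define bad where "bad k x y \<longleftrightarrow> y \<in> {a..b} \<and> y \<noteq> x \<and>
    \<bar>y - x\<bar> < real (Suc k) * \<bar>F y - F x - f x * (y - x)\<bar>" for k x y
  define N where "N k = {x \<in> {a<..<b}. \<forall>d>0. \<exists>y. \<bar>y - x\<bar> < d \<and> bad k x y}" for k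
  have FF: "integral {u..v} f = F v - F u" if "a \<le> u" "u \<le> v" "v \<le> b" for u v
    using Henstock_Kurzweil_Integration.integral_combine[of a u v f] that
      integrable_on_subinterval[OF f, of a v] by (simp add: F_def)
  have "negligible (N k)" for k
    unfolding negligible_outer_le
  proof (intro allI impI)
    fix e :: real assume "e > 0"
    have fc: "f integrable_on cbox a b" using f by simp
    obtain \<gamma> where gauge: "gauge \<gamma>" and H: "\<And>p. \<lbrakk>p tagged_partial_division_of (cbox a b); \<gamma> fine p\<rbrakk> \<Longrightarrow>
             sum (\<lambda>(x,k). norm(measure lborel k *\<^sub>R f x - integral k f)) p < e / Suc k"
      using Henstock_lemma[OF fc, of "e / Suc k"] \<open>e > 0\<close> by auto
    \<comment> \<open>A pair stands for the interval between the tag \<open>x\<close> and the other end point \<open>y\<close>; \<open>c\<close> and \<open>r\<close> present it as a ball.\<close>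
    define K where "K = {(x,y). x \<in> {a<..<b} \<and> bad k x y \<and> {min x y..max x y} \<subseteq> \<gamma> x}"
    define c where "c = (\<lambda>(x,y). (x + y) / 2 :: real)"
    define r where "r = (\<lambda>(x,y). \<bar>y - x\<bar> / 2 :: real)"
    have cb: "cball (c (x,y)) (r (x,y)) = {min x y..max x y}" for x y
      by (auto simp: c_def r_def cball_def dist_real_def min_def max_def abs_if field_simps split: if_splits)
    obtain C where C: "countable C" "C \<subseteq> K"
      "pairwise (\<lambda>i j. disjnt (cball (c i) (r i)) (cball (c j) (r j))) C"
      "negligible (N k - (\<Union>i \<in> C. cball (c i) (r i)))"
    proof (rule Vitali_covering_theorem_cballs[of K r "N k" c])
      show "0 < r i" if "i \<in> K" for i using that by (auto simp: K_def r_def bad_def)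
      fix x d :: real assume x: "x \<in> N k" and d: "0 < d"
      obtain s where s: "s > 0" "ball x s \<subseteq> \<gamma> x"
        using gauge by (meson gaugeD open_contains_ball)
      obtain y where y: "\<bar>y - x\<bar> < min s d" "bad k x y"
      proof -
        have "\<forall>d>0. \<exists>y. \<bar>y - x\<bar> < d \<and> bad k x y" using x by (simp add: N_def)
        then show ?thesis using that d s by (meson min_less_iff_conj)
      qed
      have "{min x y..max x y} \<subseteq> ball x s" using y by (auto simp: dist_real_def)
      then have "(x,y) \<in> K" using x y s by (auto simp: K_def N_def)
      moreover have "x \<in> cball (c (x,y)) (r (x,y))" unfolding cb by auto
      moreover have "r (x,y) < d" using y by (auto simp: r_def)
      ultimately show "\<exists>i. i \<in> K \<and> x \<in> cball (c i) (r i) \<and> r i < d" by blast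
    qed (rule that)
    have bound: "measure lebesgue (\<Union>i\<in>D. cball (c i) (r i)) \<le> e" if D: "D \<subseteq> C" "finite D" for D
    proof -
      let ?I = "\<lambda>i. cball (c i) (r i)"
      let ?p = "(\<lambda>i. (fst i, ?I i)) ` D"
      have DK: "D \<subseteq> K" using D C by auto
      have pos: "r i > 0" if "i \<in> D" for i using that DK by (auto simp: K_def r_def bad_def)
      have dis: "?I i \<inter> ?I j = {}" if "i \<in> D" "j \<in> D" "i \<noteq> j" for i j
        using C(3) D that by (auto simp: pairwise_def disjnt_def)
      have inj: "inj_on (\<lambda>i. (fst i, ?I i)) D"
      proof (rule inj_onI, rule ccontr)
        fix i j assume *: "i \<in> D" "j \<in> D" "(fst i, ?I i) = (fst j, ?I j)" "i \<noteq> j"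
        then have "?I i = {}" using dis[of i j] by auto
        then show False using pos[OF *(1)] by auto
      qed
      have sub: "?I i \<subseteq> {a..b} \<and> fst i \<in> ?I i \<and> ?I i \<subseteq> \<gamma> (fst i)
          \<and> (\<exists>u v. ?I i = cbox u v)" if "i \<in> D" for i
      proof -
        obtain x y where i: "i = (x,y)" by force
        have "(x,y) \<in> K" using that DK i by auto
        then have "x \<in> {a<..<b}" "y \<in> {a..b}" "{min x y..max x y} \<subseteq> \<gamma> x"
          by (auto simp: K_def bad_def)
        then show ?thesis unfolding i cb
          by (intro conjI exI[of _ "min x y"] exI[of _ "max x y"]) auto
      qed
      have "?p tagged_partial_division_of (cbox a b)"
        unfolding tagged_partial_division_of_def
      proof (intro conjI allI impI)
        show "finite ?p" using D by simp
        fix x k assume "(x, k) \<in> ?p"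
        then obtain i where "i \<in> D" "x = fst i" "k = ?I i" by blast
        with sub[of i] show "x \<in> k" "k \<subseteq> cbox a b" "\<exists>u v. k = cbox u v"
          by simp_all
      next
        fix x1 k1 x2 k2 assume "(x1, k1) \<in> ?p \<and> (x2, k2) \<in> ?p \<and> (x1, k1) \<noteq> (x2, k2)"
        then obtain i j where "i \<in> D" "j \<in> D" "i \<noteq> j" "k1 = ?I i" "k2 = ?I j" by blast
        then show "interior k1 \<inter> interior k2 = {}"
          using dis[of i j] interior_subset[of k1] interior_subset[of k2] by blast
      qed
      moreover have "\<gamma> fine ?p" using sub by (auto simp: fine_def)
      ultimately have "sum (\<lambda>(x,k). norm(measure lborel k *\<^sub>R f x - integral k f)) ?p < e / Suc k" by (rule H)
      then have S: "(\<Sum>i\<in>D. norm (measure lborel (?I i) *\<^sub>R f (fst i) - integral (?I i) f)) < e / Suc k"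
        by (subst (asm) sum.reindex[OF inj]) (simp add: o_def)
      have le: "measure lebesgue (?I i) \<le> Suc k * norm (measure lborel (?I i) *\<^sub>R f (fst i) - integral (?I i) f)"
        if "i \<in> D" for i
      proof -
        obtain x y where i: "i = (x,y)" by force
        have "(x,y) \<in> K" using that DK i by auto
        then have *: "x \<in> {a<..<b}" "y \<in> {a..b}" "\<bar>y - x\<bar> < real (Suc k) * \<bar>F y - F x - f x * (y - x)\<bar>"
          by (auto simp: K_def bad_def)
        have "norm (measure lborel (?I i) *\<^sub>R f (fst i) - integral (?I i) f) = \<bar>F y - F x - f x * (y - x)\<bar>"
          unfolding i cb using *
          by (cases "x \<le> y") (simp_all add: FF min_def max_def algebra_simps)
        moreover have "measure lebesgue (?I i) = \<bar>y - x\<bar>"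
          unfolding i cb by (simp add: min_def max_def)
        ultimately show ?thesis using * by simp
      qed
      have "measure lebesgue (\<Union>i\<in>D. ?I i) \<le> (\<Sum>i\<in>D. measure lebesgue (?I i))"
        by (rule measure_UNION_le) (use D in auto)
      also have "\<dots> \<le> (\<Sum>i\<in>D. Suc k * norm (measure lborel (?I i) *\<^sub>R f (fst i) - integral (?I i) f))"
        by (rule sum_mono) (rule le)
      also have "\<dots> \<le> Suc k * (e / Suc k)"
        unfolding sum_distrib_left[symmetric] using S by (intro mult_left_mono) auto
      finally show ?thesis by simp
    qed
    let ?U = "\<Union>i\<in>C. cball (c i) (r i)"
    have U: "?U \<in> lmeasurable" "measure lebesgue ?U \<le> e"
      using C(1) bound by (auto intro!: fmeasurable_UN_bound[of C _ _ e] measure_UN_bound[of C _ _ e])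
    let ?T = "?U \<union> (N k - ?U)"
    have "measure lebesgue ?T \<le> measure lebesgue ?U + measure lebesgue (N k - ?U)"
      using U C(4) by (intro measure_Un_le) (auto simp: negligible_imp_sets)
    then have mT: "measure lebesgue ?T \<le> e" using U C(4) by (simp add: negligible_imp_measure0)
    have lT: "?T \<in> lmeasurable" 
      using U(1) negligible_imp_measurable[OF C(4)] by (rule fmeasurable.Un)
    have "N k \<subseteq> ?T" by blast
    with lT mT show "\<exists>T. N k \<subseteq> T \<and> T \<in> lmeasurable \<and> measure lebesgue T \<le> e" by metis
  qed
  then have "negligible (\<Union>k. N k)" by (intro negligible_countable_Union) auto
  moreover have "{x \<in> {a<..<b}. \<not> (F has_real_derivative f x) (at x)} \<subseteq> (\<Union>k. N k)"
  proof (safe, rule ccontr)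
    fix x assume x: "x \<in> {a<..<b}" "\<not> (F has_real_derivative f x) (at x)" "x \<notin> (\<Union>k. N k)"
    have "(F has_derivative (*) (f x)) (at x)"
      unfolding has_derivative_at_alt
    proof (intro conjI allI impI bounded_linear_mult_right)
      fix e :: real assume "e > 0"
      then obtain k where k: "inverse (Suc k) < e" using reals_Archimedean by blast
      obtain d where d: "d > 0" "\<And>y. \<bar>y - x\<bar> < d \<Longrightarrow> \<not> bad k x y" using x by (auto simp: N_def)
      have "\<bar>F y - F x - f x * (y - x)\<bar> \<le> e * \<bar>y - x\<bar>" if y: "\<bar>y - x\<bar> < min d (min (x - a) (b - x))" for y
      proof (cases "y = x")
        case False
        have "y \<in> {a..b}" using y by auto
        then have "real (Suc k) * \<bar>F y - F x - f x * (y - x)\<bar> \<le> \<bar>y - x\<bar>"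
          using d(2)[of y] y False by (auto simp: bad_def)
        then have "\<bar>F y - F x - f x * (y - x)\<bar> \<le> inverse (Suc k) * \<bar>y - x\<bar>" 
          by (simp add: field_simps)
        also have "\<dots> \<le> e * \<bar>y - x\<bar>" using k by (intro mult_right_mono) auto
        finally show ?thesis .
      qed auto
      then show "\<exists>d>0. \<forall>y. norm (y - x) < d \<longrightarrow> norm (F y - F x - f x * (y - x)) \<le> e * norm (y - x)"
        using x d by (intro exI[of _ "min d (min (x - a) (b - x))"]) auto
    qed
    then show False using x by (simp add: has_field_derivative_def)
  qed
  ultimately show ?thesis unfolding F_def by (rule negligible_subset)
qed

section \<open>Measures on the line and their distribution functions\<close>

lemma borel_measure_eqI_atMost:
  fixes \<mu> \<nu> :: "real measure"
  assumes \<mu>: "sets \<mu> = sets borel" and \<nu>: "sets \<nu> = sets borel"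
    and eq: "\<And>b. emeasure \<mu> {..b} = emeasure \<nu> {..b}" and fin: "\<And>b. emeasure \<mu> {..b} < \<infinity>"
  shows "\<mu> = \<nu>"
proof (rule measure_eqI_generator_eq)
  let ?E = "range (atMost :: real \<Rightarrow> real set)"
  show "Int_stable ?E" by (auto simp: Int_stable_def intro: rangeI)
  show "?E \<subseteq> Pow UNIV" by simp
  show "sets \<mu> = sigma_sets UNIV ?E" "sets \<nu> = sigma_sets UNIV ?E"
    using \<mu> \<nu> by (simp_all add: borel_eq_atMost)
  show "emeasure \<mu> A = emeasure \<nu> A" if "A \<in> ?E" for A using that eq by auto
  show "range (\<lambda>n. {..real n}) \<subseteq> ?E" by auto
  show "(\<Union>n. {..real n}) = UNIV" by (auto simp: real_arch_simple)
  show "emeasure \<mu> {..real n} \<noteq> \<infinity>" for n using fin[of "real n"] by simp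
qed

text \<open>
  The derivative of a distribution function is a version of the Radon-Nikodym density. At points
  where \<open>B\<close> is not differentiable \<open>deriv\<close> has an arbitrary value, but they form a null set.
\<close>

lemma nn_integral_abs_continuous_eq_deriv:
  fixes \<mu> :: "real measure" and B :: "real \<Rightarrow> real" and \<phi> :: "real \<Rightarrow> ennreal"
  assumes \<mu>[measurable_cong]: "sets \<mu> = sets borel" and ac: "absolutely_continuous lborel \<mu>"
    and null: "emeasure \<mu> {..0} = 0"
    and B: "\<And>b. 0 < b \<Longrightarrow> emeasure \<mu> {..b} = ennreal (B b)" "\<And>b. 0 < b \<Longrightarrow> 0 \<le> B b"
    and \<phi>[measurable]: "\<phi> \<in> borel_measurable borel"
  shows "(\<integral>\<^sup>+\<beta>. \<phi> \<beta> \<partial>\<mu>) = (\<integral>\<^sup>+\<beta>\<in>{0<..}. ennreal (deriv B \<beta>) * \<phi> \<beta> \<partial>lborel)"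
proof -
  have "\<exists>g\<in>borel_measurable lborel. density lborel g = \<mu>"
    by (rule sigma_finite_measure.Radon_Nikodym[OF lborel.sigma_finite_measure_axioms ac]) (simp add: \<mu>)
  then obtain g where g[measurable]: "g \<in> borel_measurable borel" and d: "density lborel g = \<mu>" by auto
  have em: "emeasure \<mu> A = (\<integral>\<^sup>+x. g x * indicator A x \<partial>lborel)" if "A \<in> sets borel" for A
    using that by (simp add: d[symmetric] emeasure_density)
  \<comment> \<open>The gauge integral needs a real-valued density; \<open>g0\<close> agrees with \<open>g\<close> almost everywhere since \<open>\<mu>\<close> is finite on \<open>{..b}\<close> and vanishes on \<open>{..0}\<close>.\<close>
  define g0 where "g0 x = indicator {0<..} x * enn2real (g x)" for x :: real
  have [measurable]: "g0 \<in> borel_measurable borel" unfolding g0_def by measurable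
  have "AE x in lborel. g x * indicator {..real (Suc n)} x \<noteq> \<infinity>" for n
    by (rule nn_integral_PInf_AE) (auto simp: em[symmetric] B)
  then have "AE x in lborel. \<forall>n. g x * indicator {..real (Suc n)} x \<noteq> \<infinity>"
    by (simp add: AE_all_countable)
  moreover have "AE x in lborel. g x * indicator {..0} x = 0"
    using null by (subst (asm) em) (auto simp: nn_integral_0_iff_AE)
  ultimately have g0: "AE x in lborel. g x = ennreal (g0 x)"
  proof eventually_elim
    case (elim x)
    obtain n where "x \<le> real (Suc n)" using real_arch_simple[of x] by (metis of_nat_le_iff le_SucI order_trans order_refl)
    then show ?case using elim(1)[rule_format, of n] elim(2)
      by (cases "0 < x") (auto simp: g0_def indicator_def less_top split: if_splits)
  qed
  have int: "(g0 has_integral B b) {0..b}" if b: "0 < b" for b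
  proof -
    have "ennreal (B b) = (\<integral>\<^sup>+x. g x * indicator {..b} x \<partial>lborel)"
      using B[OF b] em[of "{..b}"] by simp
    also have "\<dots> = (\<integral>\<^sup>+x. ennreal (g0 x * indicator {0..b} x) \<partial>lborel)"
      by (rule nn_integral_cong_AE, use g0 in eventually_elim) (auto simp: g0_def indicator_def)
    finally have "((\<lambda>x. g0 x * indicator {0..b} x) has_integral B b) UNIV"
      by (intro nn_integral_has_integral) (auto simp: g0_def B b)
    then show ?thesis
      by (subst has_integral_restrict_UNIV[symmetric]) (simp add: indicator_def of_bool_def if_distrib mult.commute cong: if_cong)
  qed
  have "AE x in lborel. x \<in> {0<..<real (Suc n)} \<longrightarrow> (B has_real_derivative g0 x) (at x)" for n
  proof -
    have "negligible {x \<in> {0<..<real (Suc n)}. \<not> ((\<lambda>u. integral {0..u} g0) has_real_derivative g0 x) (at x)}"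
      using int[of "real (Suc n)"] by (intro indefinite_integral_has_derivative_ae) auto
    then have "AE x in lebesgue. x \<notin> {x \<in> {0<..<real (Suc n)}.
        \<not> ((\<lambda>u. integral {0..u} g0) has_real_derivative g0 x) (at x)}"
      unfolding negligible_iff_null_sets by (rule AE_not_in)
    then have "AE x in lborel. x \<notin> {x \<in> {0<..<real (Suc n)}.
        \<not> ((\<lambda>u. integral {0..u} g0) has_real_derivative g0 x) (at x)}"
      by (simp only: AE_completion_iff)
    then show ?thesis
    proof eventually_elim
      case (elim x)
      show ?case
      proof
        assume x: "x \<in> {0<..<real (Suc n)}"
        with elim have "((\<lambda>u. integral {0..u} g0) has_real_derivative g0 x) (at x)" by auto
        then show "(B has_real_derivative g0 x) (at x)"
          by (rule has_field_derivative_transform_within_open[of _ _ _ "{0<..}"])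
            (use x int in \<open>auto simp: integral_unique\<close>)
      qed
    qed
  qed
  then have "AE x in lborel. \<forall>n. x \<in> {0<..<real (Suc n)} \<longrightarrow> (B has_real_derivative g0 x) (at x)"
    by (simp only: AE_all_countable) blast
  then have deriv: "AE x in lborel. 0 < x \<longrightarrow> deriv B x = g0 x"
  proof eventually_elim
    case (elim x)
    obtain n where "x < real (Suc n)" using reals_Archimedean2[of x] by (metis less_Suc_eq of_nat_less_iff order_less_trans lessI)
    then show ?case using elim by (auto intro!: DERIV_imp_deriv)
  qed
  have "(\<integral>\<^sup>+\<beta>. \<phi> \<beta> \<partial>\<mu>) = (\<integral>\<^sup>+\<beta>. g \<beta> * \<phi> \<beta> \<partial>lborel)"
    by (simp add: d[symmetric] nn_integral_density)
  also have "\<dots> = (\<integral>\<^sup>+\<beta>\<in>{0<..}. ennreal (deriv B \<beta>) * \<phi> \<beta> \<partial>lborel)"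
    by (rule nn_integral_cong_AE, use g0 deriv in eventually_elim) (auto simp: g0_def indicator_def)
  finally show ?thesis .
qed

section \<open>The Laplace functional of a Poisson process\<close>

text \<open>
  Extending \<open>exp(-x)\<close> continuously by \<open>0\<close> at \<open>\<infinity>\<close> lets products with vanishing factors be
  written as exponentials of sums.
\<close>

definition exp_minus :: "ennreal \<Rightarrow> ennreal"
  where "exp_minus x = (if x = \<top> then 0 else ennreal (exp (- enn2real x)))"

lemma exp_minus_ennreal: "0 \<le> r \<Longrightarrow> exp_minus (ennreal r) = ennreal (exp (- r))"
  by (simp add: exp_minus_def)

lemma exp_minus_top [simp]: "exp_minus \<top> = 0"
  by (simp add: exp_minus_def)

lemma exp_minus_0 [simp]: "exp_minus 0 = 1"
  by (simp add: exp_minus_def)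

lemma exp_minus_add: "exp_minus (x + y) = exp_minus x * exp_minus y"
  by (cases x; cases y) (simp_all add: exp_minus_ennreal flip: ennreal_plus ennreal_mult exp_add)

lemma exp_minus_sum: "exp_minus (\<Sum>i\<in>I. x i) = (\<Prod>i\<in>I. exp_minus (x i))"
  by (induction I rule: infinite_finite_induct) (simp_all add: exp_minus_add)

lemma exp_minus_antimono: "x \<le> y \<Longrightarrow> exp_minus y \<le> exp_minus x"
  by (cases x; cases y) (auto simp: exp_minus_ennreal top_unique intro!: ennreal_leI)

lemma exp_minus_le_1 [simp]: "exp_minus x \<le> 1"
  using exp_minus_antimono[of 0 x] by simp

lemma exp_minus_neq_top [simp]: "exp_minus x \<noteq> \<top>"
  by (simp add: exp_minus_def)

lemma exp_minus_measurable [measurable]: "exp_minus \<in> borel_measurable borel"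
  unfolding exp_minus_def by measurable

lemma tendsto_exp_minus:
  assumes "(u \<longlongrightarrow> x) F"
  shows "((\<lambda>i. exp_minus (u i)) \<longlongrightarrow> exp_minus x) F"
proof (cases x)
  case (real r)
  have "eventually (\<lambda>i. u i < \<top>) F" using assms real by (auto intro: order_tendstoD)
  then have "eventually (\<lambda>i. ennreal (exp (- enn2real (u i))) = exp_minus (u i)) F"
    by eventually_elim (auto simp: exp_minus_def)
  moreover have "((\<lambda>i. ennreal (exp (- enn2real (u i)))) \<longlongrightarrow> ennreal (exp (- r))) F"
    using assms real by (intro tendsto_intros) auto
  ultimately show ?thesis using real by (auto simp: exp_minus_ennreal intro: Lim_transform_eventually)
next
  case top
  show ?thesis unfolding top exp_minus_top
  proof (rule order_tendstoI)
    fix a :: ennreal assume a: "0 < a"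
    obtain b where "0 < b" "b < a" using dense[OF a] by blast
    then obtain s where s: "0 < s" "ennreal s < a" by (cases b) auto
    define K where "K = max 0 (- ln s)"
    have "eventually (\<lambda>i. ennreal K < u i) F" using assms top by (auto intro: order_tendstoD)
    then show "eventually (\<lambda>i. exp_minus (u i) < a) F"
    proof eventually_elim
      case (elim i)
      then have "exp_minus (u i) \<le> exp_minus (ennreal K)" by (intro exp_minus_antimono) simp
      also have "\<dots> = ennreal (exp (- K))" by (subst exp_minus_ennreal) (simp_all add: K_def)
      also have "\<dots> \<le> ennreal (exp (ln s))" by (intro ennreal_leI) (simp add: K_def)
      also have "\<dots> < a" using s by simp
      finally show ?case .
    qed
  qed simp
qed

lemma exp_minus_suminf:
  "(\<lambda>n. \<Prod>i<n. exp_minus (x i)) \<longlonglongrightarrow> exp_minus (\<Sum>i. x i)"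
  using tendsto_exp_minus[OF summable_LIMSEQ[of x]] by (simp add: exp_minus_sum)

lemma point_count_measurable [measurable]:
  assumes [measurable]: "\<And>n. P n \<in> borel_measurable M" "A \<in> sets borel"
  shows "point_count P A \<in> borel_measurable M"
proof -
  have [measurable]: "(\<lambda>\<omega>. indicator A (P n \<omega>) :: ennreal) \<in> borel_measurable M" for n
    by (rule measurable_compose[OF assms(1) borel_measurable_indicator[OF assms(2)]])
  have "(\<lambda>\<omega>. \<Sum>n. indicator A (P n \<omega>) :: ennreal) \<in> borel_measurable M" by measurable
  then show ?thesis by (simp add: point_count_def[abs_def])
qed

text \<open>
  The count is a priori valued in \<open>[0, \<infinity>]\<close>. The Poisson probabilities add up to one, so it is almost
  surely a natural number.
\<close>

lemma (in prob_space) nn_integral_poisson_count: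
  assumes P: "homogeneous_poisson_process M lam P" and lam: "0 \<le> lam"
    and A: "A \<in> sets borel" "emeasure lborel A < \<infinity>"
    and \<phi>[measurable]: "\<phi> \<in> borel_measurable borel"
  defines "a \<equiv> lam * measure lborel A"
  shows "(\<integral>\<^sup>+\<omega>. \<phi> (point_count P A \<omega>) \<partial>M) = (\<Sum>k. \<phi> (of_nat k) * ennreal (a ^ k / fact k * exp (- a)))"
proof -
  have [measurable]: "P n \<in> borel_measurable M" for n
    using P by (simp add: homogeneous_poisson_process_def)
  note [measurable] = A(1)
  define E where "E k = {\<omega> \<in> space M. point_count P A \<omega> = of_nat k}" for k :: nat
  have E[measurable]: "E k \<in> sets M" for k unfolding E_def by measurable
  have a: "0 \<le> a" using lam by (simp add: a_def)
  have mE: "emeasure M (E k) = ennreal (a ^ k / fact k * exp (- a))" for k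
    using P A by (simp add: homogeneous_poisson_process_def E_def a_def emeasure_eq_measure)
  have "(\<lambda>k. a ^ k / fact k * exp (- a)) sums (exp a * exp (- a))"
    using exp_converges[of a] by (intro sums_mult2) (simp add: field_simps)
  then have "(\<lambda>k. a ^ k / fact k * exp (- a)) sums 1" by (simp add: exp_minus)
  then have "(\<Sum>k. emeasure M (E k)) = 1"
    unfolding mE using a by (subst suminf_ennreal_eq) auto
  moreover have "disjoint_family E" by (auto simp: disjoint_family_on_def E_def)
  ultimately have "emeasure M (\<Union>k. E k) = 1" by (subst suminf_emeasure[symmetric]) auto
  then have "AE \<omega> in M. \<omega> \<in> (\<Union>k. E k)" by (intro AE_prob_1) (simp add: measure_def)
  then have "AE \<omega> in M. \<phi> (point_count P A \<omega>) = (\<Sum>k. \<phi> (of_nat k) * indicator (E k) \<omega>)"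
  proof eventually_elim
    case (elim \<omega>)
    then obtain k where k: "\<omega> \<in> E k" by auto
    then have "(\<Sum>j. \<phi> (of_nat j) * indicator (E j) \<omega>) = (\<Sum>j. if j = k then \<phi> (of_nat k) else 0)"
      by (intro suminf_cong) (auto simp: E_def indicator_def)
    also have "\<dots> = \<phi> (of_nat k)"
      using suminf_finite[of "{k}" "\<lambda>j. if j = k then \<phi> (of_nat k) else 0"] by simp
    finally show ?case using k by (simp add: E_def)
  qed
  then have "(\<integral>\<^sup>+\<omega>. \<phi> (point_count P A \<omega>) \<partial>M) = (\<integral>\<^sup>+\<omega>. (\<Sum>k. \<phi> (of_nat k) * indicator (E k) \<omega>) \<partial>M)"
    by (rule nn_integral_cong_AE)
  also have "\<dots> = (\<Sum>k. \<phi> (of_nat k) * emeasure M (E k))"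
    by (subst nn_integral_suminf) (auto simp: nn_integral_cmult_indicator)
  finally show ?thesis by (simp add: mE)
qed

lemma (in prob_space) poisson_mean_count_finite:
  assumes P: "homogeneous_poisson_process M lam P" and lam: "0 \<le> lam"
    and A: "A \<in> sets borel" "emeasure lborel A < \<infinity>"
  shows "(\<integral>\<^sup>+\<omega>. point_count P A \<omega> \<partial>M) = ennreal lam * emeasure lborel A"
proof -
  define a where "a = lam * measure lborel A"
  have a: "0 \<le> a" using lam by (simp add: a_def)
  have "(\<lambda>k. a * (a ^ k / fact k * exp (- a))) sums (a * (exp a * exp (- a)))"
    using exp_converges[of a] by (intro sums_mult sums_mult2) (simp add: field_simps)
  moreover have "real (Suc k) * (a ^ Suc k / fact (Suc k) * exp (- a)) = a * (a ^ k / fact k * exp (- a))" for k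
    by (simp add: field_simps del: of_nat_Suc)
  ultimately have "(\<lambda>k. real (Suc k) * (a ^ Suc k / fact (Suc k) * exp (- a))) sums a"
    by (simp add: exp_minus del: of_nat_Suc fact_Suc power_Suc)
  then have s: "(\<lambda>k. real k * (a ^ k / fact k * exp (- a))) sums a"
    using sums_Suc_iff[of "\<lambda>k. real k * (a ^ k / fact k * exp (- a))" a] by simp
  have "(\<integral>\<^sup>+\<omega>. point_count P A \<omega> \<partial>M) = (\<Sum>k. of_nat k * ennreal (a ^ k / fact k * exp (- a)))"
    using nn_integral_poisson_count[OF P lam A, of "\<lambda>x. x"] by (simp add: a_def)
  also have "\<dots> = (\<Sum>k. ennreal (real k * (a ^ k / fact k * exp (- a))))"
    using a by (intro suminf_cong) (subst ennreal_mult, auto simp: ennreal_of_nat_eq_real_of_nat)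
  also have "\<dots> = ennreal a" using s a by (intro suminf_ennreal_eq) auto
  also have "\<dots> = ennreal lam * emeasure lborel A"
    using A lam by (simp add: a_def ennreal_mult emeasure_eq_ennreal_measure)
  finally show ?thesis .
qed

lemma (in prob_space) poisson_mean_count:
  assumes P: "homogeneous_poisson_process M lam P" and lam: "0 \<le> lam" and A: "A \<in> sets borel"
  shows "(\<integral>\<^sup>+\<omega>. point_count P A \<omega> \<partial>M) = ennreal lam * emeasure lborel A"
proof -
  have [measurable]: "P n \<in> borel_measurable M" for n
    using P by (simp add: homogeneous_poisson_process_def)
  note [measurable] = A
  let ?B = "\<lambda>k. A \<inter> ball 0 (real k)"
  have fin: "emeasure lborel (?B k) < \<infinity>" for k
    using emeasure_mono[of "?B k" "ball 0 (real k)" lborel] emeasure_lborel_ball_finite[of 0 "real k"]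
    by (auto intro: le_less_trans)
  have inc: "incseq ?B" by (auto simp: incseq_def)
  have U: "(\<Union>k. ?B k) = A" using reals_Archimedean2 by auto
  have "(\<lambda>k. \<integral>\<^sup>+\<omega>. point_count P (?B k) \<omega> \<partial>M) \<longlonglongrightarrow> (\<integral>\<^sup>+\<omega>. point_count P A \<omega> \<partial>M)"
  proof (rule nn_integral_LIMSEQ)
    show "incseq (\<lambda>k. point_count P (?B k))"
      using inc unfolding incseq_def le_fun_def point_count_def
      by (intro allI impI suminf_le summableI) (auto simp: indicator_def)
    show "point_count P (?B k) \<in> borel_measurable M" for k by measurable
    fix \<omega>
    have "(\<lambda>k. \<integral>\<^sup>+n. indicator (?B k) (P n \<omega>) \<partial>count_space UNIV) \<longlonglongrightarrow> (\<integral>\<^sup>+n. indicator A (P n \<omega>) \<partial>count_space UNIV)"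
    proof (rule nn_integral_LIMSEQ)
      show "incseq (\<lambda>k n. indicator (?B k) (P n \<omega>) :: ennreal)"
        using inc by (auto simp: incseq_def le_fun_def indicator_def)
      show "(\<lambda>k. indicator (?B k) (P n \<omega>)) \<longlonglongrightarrow> (indicator A (P n \<omega>) :: ennreal)" for n
        using LIMSEQ_indicator_incseq[OF inc, of "P n \<omega>"] unfolding U .
    qed simp
    then show "(\<lambda>k. point_count P (?B k) \<omega>) \<longlonglongrightarrow> point_count P A \<omega>"
      by (simp add: nn_integral_count_space_nat point_count_def)
  qed
  moreover have "(\<lambda>k. \<integral>\<^sup>+\<omega>. point_count P (?B k) \<omega> \<partial>M) \<longlonglongrightarrow> ennreal lam * emeasure lborel A"
  proof -
    have "(\<lambda>k. ennreal lam * emeasure lborel (?B k)) \<longlonglongrightarrow> ennreal lam * emeasure lborel (\<Union>k. ?B k)"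
      by (intro ennreal_tendsto_cmult Lim_emeasure_incseq inc) auto
    then show "(\<lambda>k. \<integral>\<^sup>+\<omega>. point_count P (?B k) \<omega> \<partial>M) \<longlonglongrightarrow> ennreal lam * emeasure lborel A"
      unfolding U by (simp add: poisson_mean_count_finite[OF P lam _ fin])
  qed
  ultimately show ?thesis by (rule LIMSEQ_unique)
qed

lemma (in prob_space) poisson_laplace_count:
  assumes P: "homogeneous_poisson_process M lam P" and lam: "0 \<le> lam"
    and A: "A \<in> sets borel" "emeasure lborel A < \<infinity>" and c: "0 \<le> c"
  shows "(\<integral>\<^sup>+\<omega>. exp_minus (ennreal c * point_count P A \<omega>) \<partial>M) =
    exp_minus (ennreal lam * ((1 - exp_minus (ennreal c)) * emeasure lborel A))"
proof -
  define a where "a = lam * measure lborel A"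
  have a: "0 \<le> a" using lam by (simp add: a_def)
  have "(\<lambda>k. (exp (- c) * a) ^ k / fact k * exp (- a)) sums (exp (exp (- c) * a) * exp (- a))"
    using exp_converges[of "exp (- c) * a"] by (intro sums_mult2) (simp add: field_simps)
  then have s: "(\<lambda>k. (exp (- c) * a) ^ k / fact k * exp (- a)) sums exp (- (a * (1 - exp (- c))))"
    by (simp add: algebra_simps flip: exp_add)
  have t: "exp_minus (ennreal c * of_nat k) * ennreal (a ^ k / fact k * exp (- a)) =
      ennreal ((exp (- c) * a) ^ k / fact k * exp (- a))" for k
  proof -
    have "exp_minus (ennreal c * of_nat k) = ennreal (exp (- c) ^ k)"
      using c by (simp add: ennreal_of_nat_eq_real_of_nat exp_minus_ennreal exp_of_nat_mult[symmetric]
          mult.commute flip: ennreal_mult)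
    then show ?thesis using a by (simp add: power_mult_distrib flip: ennreal_mult)
  qed
  have "(\<integral>\<^sup>+\<omega>. exp_minus (ennreal c * point_count P A \<omega>) \<partial>M) =
      (\<Sum>k. exp_minus (ennreal c * of_nat k) * ennreal (a ^ k / fact k * exp (- a)))"
    unfolding a_def by (rule nn_integral_poisson_count[OF P lam A]) measurable
  also have "\<dots> = ennreal (exp (- (a * (1 - exp (- c)))))"
    unfolding t using a s by (intro suminf_ennreal_eq) auto
  also have "\<dots> = exp_minus (ennreal (a * (1 - exp (- c))))"
    using a c by (simp add: exp_minus_ennreal)
  also have "ennreal (a * (1 - exp (- c))) =
      ennreal lam * ((1 - exp_minus (ennreal c)) * emeasure lborel A)"
    using A lam c by (simp add: a_def exp_minus_ennreal ennreal_mult emeasure_eq_ennreal_measure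
        ennreal_1[symmetric] ennreal_minus ac_simps del: ennreal_1)
  finally show ?thesis .
qed

text \<open>
  For a step function over disjoint cells the sum over the points is a linear combination of
  independent Poisson counts, so the expectation factorizes.
\<close>

lemma (in prob_space) poisson_laplace_simple:
  assumes P: "homogeneous_poisson_process M lam P" and lam: "0 \<le> lam"
    and \<A>: "finite \<A>" "\<A> \<subseteq> {A \<in> sets borel. emeasure lborel A < \<infinity>}" "disjoint \<A>"
    and c: "\<And>A. 0 \<le> c A"
  defines "W \<equiv> (\<lambda>y. \<Sum>A\<in>\<A>. ennreal (c A) * indicator A y)"
  shows "(\<integral>\<^sup>+\<omega>. exp_minus (\<Sum>n. W (P n \<omega>)) \<partial>M) =
    exp_minus (ennreal lam * (\<integral>\<^sup>+y. 1 - exp_minus (W y) \<partial>lborel))"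
proof -
  have A: "A \<in> sets borel" "emeasure lborel A < \<infinity>" if "A \<in> \<A>" for A using that \<A> by auto
  have ind: "indep_vars (\<lambda>_. borel) (point_count P) \<A>"
    using P \<A> by (auto simp: homogeneous_poisson_process_def)
  have W1: "1 - exp_minus (W y) = (\<Sum>A\<in>\<A>. (1 - exp_minus (ennreal (c A))) * indicator A y)" for y
  proof -
    have *: "(\<Sum>A\<in>\<A>. g A * indicator A y) = (\<Sum>A\<in>{A\<in>\<A>. y \<in> A}. g A)" for g :: "_ \<Rightarrow> ennreal"
      using \<A>(1) by (intro sum.mono_neutral_cong_right) (auto simp: indicator_def)
    show ?thesis
    proof (cases "{A\<in>\<A>. y \<in> A} = {}")
      case True
      then show ?thesis unfolding W_def * True by simp
    next
      case False
      then obtain A where "A \<in> \<A>" "y \<in> A" by auto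
      then have **: "{A\<in>\<A>. y \<in> A} = {A}" using \<A>(3) by (auto simp: disjoint_def)
      show ?thesis unfolding W_def * ** by simp
    qed
  qed
  have "(\<Sum>n. W (P n \<omega>)) = (\<Sum>A\<in>\<A>. ennreal (c A) * point_count P A \<omega>)" for \<omega>
    unfolding W_def point_count_def by (subst suminf_sum) auto
  then have "(\<integral>\<^sup>+\<omega>. exp_minus (\<Sum>n. W (P n \<omega>)) \<partial>M) =
      (\<integral>\<^sup>+\<omega>. (\<Prod>A\<in>\<A>. exp_minus (ennreal (c A) * point_count P A \<omega>)) \<partial>M)"
    by (simp add: exp_minus_sum)
  also have "\<dots> = (\<Prod>A\<in>\<A>. \<integral>\<^sup>+\<omega>. exp_minus (ennreal (c A) * point_count P A \<omega>) \<partial>M)"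
    using \<A>(1) by (intro indep_vars_nn_integral indep_vars_compose2[OF ind]) auto
  also have "\<dots> = (\<Prod>A\<in>\<A>. exp_minus (ennreal lam * ((1 - exp_minus (ennreal (c A))) * emeasure lborel A)))"
    using A c by (intro prod.cong refl poisson_laplace_count[OF P lam]) auto
  also have "\<dots> = exp_minus (ennreal lam * (\<Sum>A\<in>\<A>. (1 - exp_minus (ennreal (c A))) * emeasure lborel A))"
    by (simp add: exp_minus_sum sum_distrib_left)
  also have "(\<Sum>A\<in>\<A>. (1 - exp_minus (ennreal (c A))) * emeasure lborel A) =
      (\<integral>\<^sup>+y. 1 - exp_minus (W y) \<partial>lborel)"
    unfolding W1 using A by (subst nn_integral_sum) (auto simp: nn_integral_cmult_indicator)
  finally show ?thesis .
qed

text \<open>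
  Monotone approximation by simple functions supported in bounded balls, whose level sets have
  finite volume. On the left-hand side the integrands decrease and are bounded by \<open>1\<close>, on the
  right-hand side \<open>1 - exp_minus W\<close> increases.
\<close>

lemma (in prob_space) poisson_laplace_functional:
  fixes P :: "nat \<Rightarrow> 'a \<Rightarrow> 'b::euclidean_space"
  assumes P: "homogeneous_poisson_process M lam P" and lam: "0 \<le> lam"
    and W[measurable]: "W \<in> borel_measurable borel"
  shows "(\<integral>\<^sup>+\<omega>. exp_minus (\<Sum>n. W (P n \<omega>)) \<partial>M) =
    exp_minus (ennreal lam * (\<integral>\<^sup>+y. 1 - exp_minus (W y) \<partial>lborel))"
proof -
  have [measurable]: "P n \<in> borel_measurable M" for n
    using P by (simp add: homogeneous_poisson_process_def)
  obtain U where U: "\<And>i. simple_function borel (U i)" "incseq U" "\<And>i x. U i x < \<top>"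
    "\<And>x. (SUP i. U i x) = W x"
    using borel_measurable_implies_simple_function_sequence'[OF W] by blast
  define V where "V i y = U i y * indicator (ball 0 (real i)) y" for i y
  have V: "simple_function borel (V i)" for i
    unfolding V_def using U(1) by (intro simple_function_mult simple_function_indicator) auto
  have [measurable]: "V i \<in> borel_measurable borel" for i
    using V by (rule borel_measurable_simple_function)
  have Vinc: "incseq V"
    using U(2) by (auto simp: incseq_def le_fun_def V_def indicator_def)
  have Vlim: "(\<lambda>i. V i y) \<longlonglongrightarrow> W y" for y
  proof -
    obtain k where k: "norm y < real k" using reals_Archimedean2 by blast
    have "(\<lambda>i. U i y) \<longlonglongrightarrow> W y"
      using LIMSEQ_SUP[of "\<lambda>i. U i y"] U(2,4) by (auto simp: incseq_def le_fun_def)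
    moreover have "eventually (\<lambda>i. U i y = V i y) sequentially"
      using eventually_ge_at_top[of k] by eventually_elim (use k in \<open>auto simp: V_def\<close>)
    ultimately show ?thesis by (rule Lim_transform_eventually)
  qed
  have step: "(\<integral>\<^sup>+\<omega>. exp_minus (\<Sum>n. V i (P n \<omega>)) \<partial>M) =
    exp_minus (ennreal lam * (\<integral>\<^sup>+y. 1 - exp_minus (V i y) \<partial>lborel))" for i
  proof -
    let ?R = "range (V i) - {0}"
    define \<A> where "\<A> = (\<lambda>c. V i -` {c}) ` ?R"
    define c where "c A = enn2real (V i (SOME y. y \<in> A))" for A
    have fin: "finite ?R" using V[of i] by (simp add: simple_function_def)
    have c: "ennreal (c (V i -` {r})) = r" if "r \<in> ?R" for r
    proof -
      obtain y where y: "V i y = r" using \<open>r \<in> ?R\<close> by blast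
      have "(SOME y. y \<in> V i -` {r}) \<in> V i -` {r}" by (rule someI[of _ y]) (simp add: y)
      moreover have "r < \<top>" using U(3)[of i y] y by (auto simp: V_def indicator_def)
      ultimately show ?thesis by (simp add: c_def)
    qed
    have inj: "inj_on (\<lambda>c. V i -` {c}) ?R" by (auto simp: inj_on_def)
    have "V i y = (\<Sum>A\<in>\<A>. ennreal (c A) * indicator A y)" for y
    proof -
      have "(\<Sum>A\<in>\<A>. ennreal (c A) * indicator A y) = (\<Sum>r\<in>?R. r * indicator (V i -` {r}) y)"
        unfolding \<A>_def by (subst sum.reindex[OF inj]) (simp add: c)
      also have "\<dots> = (\<Sum>r\<in>?R. if r = V i y then V i y else 0)"
        by (intro sum.cong) (auto simp: indicator_def)
      also have "\<dots> = V i y" using fin by (subst sum.delta) auto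
      finally show ?thesis by simp
    qed
    then have Veq: "V i = (\<lambda>y. \<Sum>A\<in>\<A>. ennreal (c A) * indicator A y)" by auto
    show ?thesis unfolding Veq
    proof (rule poisson_laplace_simple[OF P lam])
      show "finite \<A>" using fin by (simp add: \<A>_def)
      show "disjoint \<A>" by (auto simp: \<A>_def disjoint_def)
      show "0 \<le> c A" for A by (simp add: c_def)
      show "\<A> \<subseteq> {A \<in> sets borel. emeasure lborel A < \<infinity>}"
      proof (clarsimp simp: \<A>_def)
        fix y assume nz: "V i y \<noteq> 0"
        have m: "V i -` {V i y} \<in> sets borel"
          using measurable_sets[of "V i" borel borel "{V i y}"] by simp
        have "V i -` {V i y} \<subseteq> ball 0 (real i)"
        proof
          fix x assume "x \<in> V i -` {V i y}"
          then have "V i x \<noteq> 0" using nz by simp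
          then show "x \<in> ball 0 (real i)" by (rule contrapos_np) (simp add: V_def)
        qed
        then have "emeasure lborel (V i -` {V i y}) \<le> emeasure lborel (ball (0::'b) (real i))"
          by (intro emeasure_mono) auto
        also have "\<dots> < \<infinity>" using emeasure_lborel_ball_finite[of "0::'b" "real i"] by simp
        finally show "V i -` {V i y} \<in> sets borel \<and> emeasure lborel (V i -` {V i y}) < \<top>"
          using m by simp
      qed
    qed
  qed
  have "(\<lambda>i. \<integral>\<^sup>+\<omega>. exp_minus (\<Sum>n. V i (P n \<omega>)) \<partial>M) \<longlonglongrightarrow> (\<integral>\<^sup>+\<omega>. exp_minus (\<Sum>n. W (P n \<omega>)) \<partial>M)"
  proof (rule nn_integral_dominated_convergence[where w = "\<lambda>_. 1"])
    show "(\<integral>\<^sup>+\<omega>. 1 \<partial>M) < \<infinity>" by (simp add: emeasure_space_1)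
    have "(\<lambda>i. \<integral>\<^sup>+n. V i (P n \<omega>) \<partial>count_space UNIV) \<longlonglongrightarrow> (\<integral>\<^sup>+n. W (P n \<omega>) \<partial>count_space UNIV)" for \<omega>
      using Vinc by (intro nn_integral_LIMSEQ Vlim) (auto simp: incseq_def le_fun_def)
    then show "AE \<omega> in M. (\<lambda>i. exp_minus (\<Sum>n. V i (P n \<omega>))) \<longlonglongrightarrow> exp_minus (\<Sum>n. W (P n \<omega>))"
      by (intro AE_I2 tendsto_exp_minus) (simp add: nn_integral_count_space_nat)
  qed auto
  moreover have "(\<lambda>i. exp_minus (ennreal lam * (\<integral>\<^sup>+y. 1 - exp_minus (V i y) \<partial>lborel)))
      \<longlonglongrightarrow> exp_minus (ennreal lam * (\<integral>\<^sup>+y. 1 - exp_minus (W y) \<partial>lborel))"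
  proof (intro tendsto_exp_minus ennreal_tendsto_cmult nn_integral_LIMSEQ)
    show "incseq (\<lambda>i y. 1 - exp_minus (V i y))"
      using Vinc by (auto simp: incseq_def le_fun_def intro!: ennreal_minus_mono exp_minus_antimono)
    show "(\<lambda>i. 1 - exp_minus (V i y)) \<longlonglongrightarrow> 1 - exp_minus (W y)" for y
      by (intro tendsto_diff_ennreal tendsto_exp_minus Vlim tendsto_const)
        simp_all
  qed auto
  ultimately show ?thesis unfolding step by (rule LIMSEQ_unique)
qed

section \<open>Averaging over users independent of the stations\<close>

text \<open>
  The information on a point process that does not depend on the enumeration of its points, and
  the only one on which the independence of two processes bears.
\<close>

definition count_algebra :: "'w measure \<Rightarrow> (nat \<Rightarrow> 'w \<Rightarrow> 'a::euclidean_space) \<Rightarrow> 'w measure"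
  where "count_algebra M P =
    vimage_algebra (space M) (\<lambda>\<omega>. \<lambda>A\<in>sets borel. point_count P A \<omega>) (Pi\<^sub>M (sets borel) (\<lambda>_. borel))"

lemma space_count_algebra [simp]: "space (count_algebra M P) = space M"
  by (simp add: count_algebra_def)

lemma count_field_measurable:
  "(\<lambda>\<omega>. \<lambda>A\<in>sets borel. point_count P A \<omega>) \<in> count_algebra M P \<rightarrow>\<^sub>M Pi\<^sub>M (sets borel) (\<lambda>_. borel)"
  unfolding count_algebra_def by (rule measurable_vimage_algebra1) (auto simp: space_PiM)

lemma point_count_measurable_count_algebra [measurable]:
  assumes "A \<in> sets borel"
  shows "point_count P A \<in> borel_measurable (count_algebra M P)"
  using measurable_compose[OF count_field_measurable measurable_component_singleton[OF assms]] assms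
  by (simp add: cong: measurable_cong)

lemma count_algebra_subalgebra:
  assumes "\<And>n. P n \<in> borel_measurable M"
  shows "(\<lambda>\<omega>. \<omega>) \<in> M \<rightarrow>\<^sub>M count_algebra M P"
  unfolding count_algebra_def
proof (rule measurable_vimage_algebra2)
  show "(\<lambda>\<omega>. \<lambda>A\<in>sets borel. point_count P A \<omega>) \<in> M \<rightarrow>\<^sub>M Pi\<^sub>M (sets borel) (\<lambda>_. borel)"
    using assms by (intro measurable_restrict point_count_measurable) auto
qed auto

text \<open>
  Outside this event some ball contains infinitely many points, and the count of a complement is
  not obtained by subtraction. The event has probability one and is determined by the counts.
\<close>

definition locally_finite_event :: "'w measure \<Rightarrow> (nat \<Rightarrow> 'w \<Rightarrow> 'a::euclidean_space) \<Rightarrow> 'w set"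
  where "locally_finite_event M P = {\<omega> \<in> space M. \<forall>k::nat. point_count P (ball 0 (real k)) \<omega> \<noteq> \<top>}"

lemma locally_finite_event_sets [measurable]: "locally_finite_event M P \<in> sets (count_algebra M P)"
proof -
  have "{\<omega> \<in> space (count_algebra M P). \<forall>k::nat. point_count P (ball 0 (real k)) \<omega> \<noteq> \<top>}
      \<in> sets (count_algebra M P)"
    by measurable
  then show ?thesis by (simp add: locally_finite_event_def)
qed

lemma (in prob_space) AE_locally_finite_event:
  fixes P :: "nat \<Rightarrow> 'a \<Rightarrow> 'b::euclidean_space"
  assumes P: "homogeneous_poisson_process M lam P" and lam: "0 \<le> lam"
  shows "AE \<omega> in M. \<omega> \<in> locally_finite_event M P"
proof -
  have [measurable]: "P n \<in> borel_measurable M" for n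
    using P by (simp add: homogeneous_poisson_process_def)
  have "AE \<omega> in M. point_count P (ball 0 (real k)) \<omega> \<noteq> \<infinity>" for k
    using less_imp_neq[OF emeasure_lborel_ball_finite[of "0::'b" "real k"]]
    by (intro nn_integral_PInf_AE)
      (simp_all add: poisson_mean_count[OF P lam] ennreal_mult_eq_top_iff)
  then have "AE \<omega> in M. \<forall>k::nat. point_count P (ball 0 (real k)) \<omega> \<noteq> \<infinity>"
    by (simp add: AE_all_countable)
  then show ?thesis by (auto simp: locally_finite_event_def)
qed

lemma suminf_ennreal_swap:
  fixes g :: "nat \<Rightarrow> nat \<Rightarrow> ennreal"
  shows "(\<Sum>n. \<Sum>i. g i n) = (\<Sum>i. \<Sum>n. g i n)"
proof -
  have "(\<Sum>n. \<Sum>i. g i n) = (\<integral>\<^sup>+n. (\<Sum>i. g i n) \<partial>count_space UNIV)"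
    by (rule nn_integral_count_space_nat[symmetric])
  also have "\<dots> = (\<Sum>i. \<integral>\<^sup>+n. g i n \<partial>count_space UNIV)" by (rule nn_integral_suminf) simp
  finally show ?thesis by (simp add: nn_integral_count_space_nat)
qed

text \<open>
  Integrals with respect to the counting measure depend measurably on a parameter and on the
  counts jointly. A product set gives a count, and Dynkin's argument extends this to all sets of
  the product algebra; intersecting with a ball keeps the counts finite.
\<close>

lemma point_sum_ball_indicator_measurable:
  fixes P :: "nat \<Rightarrow> 'w \<Rightarrow> 'a::euclidean_space" and S :: "'b measure"
  assumes E: "E \<in> sets (S \<Otimes>\<^sub>M borel)"
  shows "(\<lambda>(\<xi>, \<omega>). indicator (locally_finite_event M P) \<omega> *
      (\<Sum>n. indicator E (\<xi>, P n \<omega>) * indicator (ball 0 (real k)) (P n \<omega>)) :: ennreal)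
    \<in> borel_measurable (S \<Otimes>\<^sub>M count_algebra M P)"
proof -
  let ?G = "locally_finite_event M P" and ?B = "ball 0 (real k) :: 'a set"
  let ?s = "\<lambda>E \<xi> \<omega>. indicator ?G \<omega> * (\<Sum>n. indicator E (\<xi>, P n \<omega>) * indicator ?B (P n \<omega>)) :: ennreal"
  let ?meas = "\<lambda>E. (\<lambda>(\<xi>, \<omega>). ?s E \<xi> \<omega>) \<in> borel_measurable (S \<Otimes>\<^sub>M count_algebra M P)"
  show ?thesis
    using Int_stable_pair_measure_generator pair_measure_closed E unfolding sets_pair_measure
  proof (induction rule: sigma_sets_induct_disjoint)
    case (basic E)
    then obtain a b where E: "E = a \<times> b" and [measurable]: "a \<in> sets S" "b \<in> sets (borel :: 'a measure)"
      by auto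
    have "?s E \<xi> \<omega> = indicator ?G \<omega> * (indicator a \<xi> * point_count P (b \<inter> ?B) \<omega>)" for \<xi> \<omega>
    proof -
      have "(\<Sum>n. indicator E (\<xi>, P n \<omega>) * indicator ?B (P n \<omega>)) =
          (\<Sum>n. indicator a \<xi> * indicator (b \<inter> ?B) (P n \<omega>) :: ennreal)"
        by (intro suminf_cong) (auto simp: E indicator_def)
      then show ?thesis by (simp add: point_count_def)
    qed
    then show ?case by simp
  next
    case empty
    show ?case by simp
  next
    case (compl E)
    have [measurable]: "(\<lambda>(\<xi>, \<omega>). ?s E \<xi> \<omega>) \<in> borel_measurable (S \<Otimes>\<^sub>M count_algebra M P)"
      by (rule compl.IH)
    have eq: "?s (space S \<times> space borel - E) \<xi> \<omega> = indicator ?G \<omega> * point_count P ?B \<omega> - ?s E \<xi> \<omega>"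
      if "\<xi> \<in> space S" for \<xi> \<omega>
    proof (cases "\<omega> \<in> ?G")
      case True
      let ?a = "\<Sum>n. indicator E (\<xi>, P n \<omega>) * indicator ?B (P n \<omega>) :: ennreal"
      let ?b = "\<Sum>n. indicator (space S \<times> space borel - E) (\<xi>, P n \<omega>) * indicator ?B (P n \<omega>) :: ennreal"
      have "?a + ?b = (\<Sum>n. indicator E (\<xi>, P n \<omega>) * indicator ?B (P n \<omega>) +
          indicator (space S \<times> space borel - E) (\<xi>, P n \<omega>) * indicator ?B (P n \<omega>))"
        by (rule suminf_add) auto
      also have "\<dots> = point_count P ?B \<omega>" unfolding point_count_def
        using that by (intro suminf_cong) (auto simp: indicator_def)
      finally have s: "?a + ?b = point_count P ?B \<omega>" .
      moreover have "point_count P ?B \<omega> \<noteq> \<top>" using True by (simp add: locally_finite_event_def)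
      ultimately have "?b = point_count P ?B \<omega> - ?a" by (auto simp flip: s)
      then show ?thesis using True by simp
    qed simp
    have "(\<lambda>(\<xi>, \<omega>). indicator ?G \<omega> * point_count P ?B \<omega> - ?s E \<xi> \<omega>)
        \<in> borel_measurable (S \<Otimes>\<^sub>M count_algebra M P)"
      by measurable
    then show ?case
      by (rule measurable_cong[THEN iffD1, rotated]) (auto simp: eq[simplified] space_pair_measure)
  next
    case (union A)
    have [measurable]: "(\<lambda>(\<xi>, \<omega>). ?s (A i) \<xi> \<omega>) \<in> borel_measurable (S \<Otimes>\<^sub>M count_algebra M P)" for i
      by (rule union.IH)
    have "?s (\<Union>i. A i) \<xi> \<omega> = (\<Sum>i. ?s (A i) \<xi> \<omega>)" for \<xi> \<omega>
    proof -
      have "(\<Sum>n. indicator (\<Union>i. A i) (\<xi>, P n \<omega>) * indicator ?B (P n \<omega>)) =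
          (\<Sum>n. \<Sum>i. indicator (A i) (\<xi>, P n \<omega>) * indicator ?B (P n \<omega>) :: ennreal)"
        using union(1) by (simp add: suminf_indicator)
      also have "\<dots> = (\<Sum>i. \<Sum>n. indicator (A i) (\<xi>, P n \<omega>) * indicator ?B (P n \<omega>))"
        by (rule suminf_ennreal_swap)
      finally show ?thesis by simp
    qed
    moreover have "(\<lambda>(\<xi>, \<omega>). \<Sum>i. ?s (A i) \<xi> \<omega>) \<in> borel_measurable (S \<Otimes>\<^sub>M count_algebra M P)"
      by measurable
    ultimately show ?case by simp
  qed
qed

lemma point_sum_measurable:
  fixes P :: "nat \<Rightarrow> 'w \<Rightarrow> 'a::euclidean_space" and S :: "'b measure"
  assumes W: "W \<in> borel_measurable (S \<Otimes>\<^sub>M borel)"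
  shows "(\<lambda>(\<xi>, \<omega>). indicator (locally_finite_event M P) \<omega> * (\<Sum>n. W (\<xi>, P n \<omega>)) :: ennreal)
    \<in> borel_measurable (S \<Otimes>\<^sub>M count_algebra M P)"
  using W
proof (induction rule: borel_measurable_induct)
  case (cong f g)
  then have "(\<lambda>(\<xi>, \<omega>). indicator (locally_finite_event M P) \<omega> * (\<Sum>n. g (\<xi>, P n \<omega>)) :: ennreal)
    \<in> borel_measurable (S \<Otimes>\<^sub>M count_algebra M P)" by simp
  then show ?case
    by (rule measurable_cong[THEN iffD2, rotated]) (use cong in \<open>auto simp: space_pair_measure\<close>)
next
  case (set E)
  let ?t = "\<lambda>k. \<lambda>(\<xi>, \<omega>). indicator (locally_finite_event M P) \<omega> *
      (\<Sum>n. indicator E (\<xi>, P n \<omega>) * indicator (ball 0 (real k)) (P n \<omega>)) :: ennreal"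
  have "(\<lambda>k. ?t k z) \<longlonglongrightarrow> (\<lambda>(\<xi>, \<omega>). indicator (locally_finite_event M P) \<omega> * (\<Sum>n. indicator E (\<xi>, P n \<omega>))) z" for z
  proof -
    obtain \<xi> \<omega> where z: "z = (\<xi>, \<omega>)" by force
    have "(\<lambda>k. \<integral>\<^sup>+n. indicator E (\<xi>, P n \<omega>) * indicator (ball 0 (real k)) (P n \<omega>) \<partial>count_space UNIV)
      \<longlonglongrightarrow> (\<integral>\<^sup>+n. indicator E (\<xi>, P n \<omega>) \<partial>count_space UNIV)"
    proof (rule nn_integral_LIMSEQ)
      show "(\<lambda>k. indicator E (\<xi>, P n \<omega>) * indicator (ball 0 (real k)) (P n \<omega>) :: ennreal)
        \<longlonglongrightarrow> indicator E (\<xi>, P n \<omega>)" for n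
      proof -
        obtain k where k: "norm (P n \<omega>) < real k" using reals_Archimedean2 by blast
        have "eventually (\<lambda>i. indicator E (\<xi>, P n \<omega>) * indicator (ball 0 (real i)) (P n \<omega>)
            = (indicator E (\<xi>, P n \<omega>) :: ennreal)) sequentially"
          using eventually_ge_at_top[of k] by eventually_elim (use k in auto)
        then show ?thesis by (rule tendsto_eventually)
      qed
    qed (auto simp: incseq_def le_fun_def indicator_def)
    then show ?thesis unfolding z
      by (cases "\<omega> \<in> locally_finite_event M P") (simp_all add: nn_integral_count_space_nat)
  qed
  then show ?case
    by (rule borel_measurable_LIMSEQ_order) (rule point_sum_ball_indicator_measurable[OF set])
next
  case (mult u c)
  then have "(\<lambda>z. c * (\<lambda>(\<xi>, \<omega>). indicator (locally_finite_event M P) \<omega> * (\<Sum>n. u (\<xi>, P n \<omega>))) z)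
    \<in> borel_measurable (S \<Otimes>\<^sub>M count_algebra M P)" by measurable
  then show ?case by (simp add: split_beta' mult.left_commute)
next
  case (add u v)
  then have "(\<lambda>z. (\<lambda>(\<xi>, \<omega>). indicator (locally_finite_event M P) \<omega> * (\<Sum>n. v (\<xi>, P n \<omega>))) z +
      (\<lambda>(\<xi>, \<omega>). indicator (locally_finite_event M P) \<omega> * (\<Sum>n. u (\<xi>, P n \<omega>))) z)
    \<in> borel_measurable (S \<Otimes>\<^sub>M count_algebra M P)" by measurable
  then show ?case by (simp add: split_beta' distrib_left add.commute flip: suminf_add)
next
  case (seq U)
  have "(\<Sum>n. (SUP i. U i) (\<xi>, P n \<omega>)) = (SUP i. \<Sum>n. U i (\<xi>, P n \<omega>))" for \<xi> \<omega>
    unfolding nn_integral_count_space_nat[symmetric] SUP_apply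
    using seq(3) by (intro nn_integral_monotone_convergence_SUP) (auto simp: incseq_def le_fun_def)
  then have eq: "(\<lambda>(\<xi>, \<omega>). indicator (locally_finite_event M P) \<omega> * (\<Sum>n. (SUP i. U i) (\<xi>, P n \<omega>))) =
      (\<lambda>z. SUP i. (\<lambda>(\<xi>, \<omega>). indicator (locally_finite_event M P) \<omega> * (\<Sum>n. U i (\<xi>, P n \<omega>))) z)"
    by (auto simp: fun_eq_iff SUP_mult_left_ennreal)
  show ?case unfolding eq using seq.IH by (intro borel_measurable_SUP) auto
qed

lemma (in prob_space) nn_integral_indep_var_mult:
  fixes u v :: "'a \<Rightarrow> ennreal"
  assumes "indep_var borel u borel v"
  shows "(\<integral>\<^sup>+\<omega>. u \<omega> * v \<omega> \<partial>M) = (\<integral>\<^sup>+\<omega>. u \<omega> \<partial>M) * (\<integral>\<^sup>+\<omega>. v \<omega> \<partial>M)"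
proof -
  have "case_bool borel borel = (\<lambda>_. borel :: ennreal measure)" by (auto split: bool.split)
  then have "indep_vars (\<lambda>_. borel) (case_bool u v) UNIV"
    using assms by (simp add: indep_var_def)
  from indep_vars_nn_integral[OF _ this] show ?thesis by (simp add: UNIV_bool mult.commute)
qed

text \<open>
  Campbell's formula with an integrand that may also depend on an independent process, through its
  counts. The measure \<open>D\<close> adds up the laws of the pairs \<open>(X\<^sub>m, \<omega>)\<close> on the algebra of those
  counts. On a rectangle \<open>A \<times> C\<close> it is the mean of the number of points in \<open>A\<close> on the event \<open>C\<close>,
  which factorizes by independence; so \<open>D\<close> is a product measure.
\<close>

lemma (in prob_space) campbell_independent:
  fixes Y X :: "nat \<Rightarrow> 'a \<Rightarrow> 'b::euclidean_space"
  assumes X: "homogeneous_poisson_process M lam X" and lam: "0 \<le> lam"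
    and Y: "\<And>n. Y n \<in> borel_measurable M"
    and ind: "independent_processes M Y X"
    and Z: "Z \<in> borel_measurable (borel \<Otimes>\<^sub>M count_algebra M Y)"
  shows "(\<integral>\<^sup>+\<omega>. (\<Sum>m. Z (X m \<omega>, \<omega>)) \<partial>M) =
    ennreal lam * (\<integral>\<^sup>+x. \<integral>\<^sup>+\<omega>. Z (x, \<omega>) \<partial>M \<partial>lborel)"
proof -
  have Xm[measurable]: "X n \<in> borel_measurable M" for n
    using X by (simp add: homogeneous_poisson_process_def)
  let ?F = "count_algebra M Y" and ?Pi = "Pi\<^sub>M (sets borel) (\<lambda>_. borel)"
  let ?NX = "\<lambda>\<omega>. \<lambda>A\<in>sets borel. point_count X A \<omega>" and ?NY = "\<lambda>\<omega>. \<lambda>A\<in>sets borel. point_count Y A \<omega>"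
  have sub[measurable]: "(\<lambda>\<omega>. \<omega>) \<in> M \<rightarrow>\<^sub>M ?F" by (rule count_algebra_subalgebra[OF Y])
  define MF where "MF = distr M ?F (\<lambda>\<omega>. \<omega>)"
  interpret MF: prob_space MF unfolding MF_def by (rule prob_space_distr[OF sub])
  define D where "D = distr (count_space UNIV \<Otimes>\<^sub>M M) (borel \<Otimes>\<^sub>M ?F) (\<lambda>(m, \<omega>). (X m \<omega>, \<omega>))"
  have [measurable]: "(\<lambda>(m, \<omega>). (X m \<omega>, \<omega>)) \<in> count_space UNIV \<Otimes>\<^sub>M M \<rightarrow>\<^sub>M borel \<Otimes>\<^sub>M ?F"
    by measurable
  have nnD: "(\<integral>\<^sup>+z. g z \<partial>D) = (\<integral>\<^sup>+\<omega>. (\<Sum>m. g (X m \<omega>, \<omega>)) \<partial>M)"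
    if [measurable]: "g \<in> borel_measurable (borel \<Otimes>\<^sub>M ?F)" for g :: "_ \<Rightarrow> ennreal"
  proof -
    have "(\<integral>\<^sup>+z. g z \<partial>D) = (\<integral>\<^sup>+(m, \<omega>). g (X m \<omega>, \<omega>) \<partial>(count_space UNIV \<Otimes>\<^sub>M M))"
      by (simp add: D_def nn_integral_distr split_beta')
    also have "\<dots> = (\<integral>\<^sup>+m. \<integral>\<^sup>+\<omega>. g (X m \<omega>, \<omega>) \<partial>M \<partial>count_space UNIV)"
      by (subst nn_integral_fst[symmetric]) (auto simp: split_beta')
    also have "\<dots> = (\<integral>\<^sup>+\<omega>. (\<Sum>m. g (X m \<omega>, \<omega>)) \<partial>M)"
      by (subst nn_integral_suminf) (auto simp: nn_integral_count_space_nat)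
    finally show ?thesis .
  qed
  have "density lborel (\<lambda>_. ennreal lam) \<Otimes>\<^sub>M MF = D"
  proof (rule pair_measure_eqI)
    show "sigma_finite_measure (density lborel (\<lambda>_. ennreal lam) :: 'b measure)"
      by (subst sigma_finite_measure.sigma_finite_iff_density_finite[OF lborel.sigma_finite_measure_axioms]) auto
    show "sigma_finite_measure MF" ..
    show "sets (density lborel (\<lambda>_. ennreal lam) \<Otimes>\<^sub>M MF) = sets D"
      by (simp add: D_def MF_def cong: sets_pair_measure_cong)
    fix A C assume "A \<in> sets (density lborel (\<lambda>_. ennreal lam) :: 'b measure)" "C \<in> sets MF"
    then have A[measurable]: "A \<in> sets borel" and C[measurable]: "C \<in> sets ?F" by (auto simp: MF_def)
    obtain C' where C'[measurable]: "C' \<in> sets ?Pi" and CC': "C = ?NY -` C' \<inter> space M"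
      using C unfolding count_algebra_def by (subst (asm) sets_vimage_algebra2) (auto simp: space_PiM)
    have iv: "indep_var ?Pi ?NY ?Pi ?NX" using ind by (simp add: independent_processes_def)
    have iv2: "indep_var borel (\<lambda>\<omega>. indicator C' (?NY \<omega>) :: ennreal) borel (\<lambda>\<omega>. ?NX \<omega> A)"
      by (rule indep_var_compose[OF iv, unfolded comp_def, of "indicator C'" borel "\<lambda>\<nu>. \<nu> A" borel])
        (use A in measurable)
    have "emeasure D (A \<times> C) = (\<integral>\<^sup>+\<omega>. (\<Sum>m. indicator (A \<times> C) (X m \<omega>, \<omega>)) \<partial>M)"
      by (subst nn_integral_indicator[symmetric], simp add: D_def, subst nnD) auto
    also have "\<dots> = (\<integral>\<^sup>+\<omega>. point_count X A \<omega> * indicator C' (?NY \<omega>) \<partial>M)"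
    proof (intro nn_integral_cong)
      fix \<omega> assume "\<omega> \<in> space M"
      then have "(\<Sum>m. indicator (A \<times> C) (X m \<omega>, \<omega>)) = (\<Sum>m. indicator A (X m \<omega>) * indicator C' (?NY \<omega>) :: ennreal)"
        by (intro suminf_cong) (auto simp: CC' indicator_def)
      then show "(\<Sum>m. indicator (A \<times> C) (X m \<omega>, \<omega>)) = point_count X A \<omega> * indicator C' (?NY \<omega>)"
        by (simp add: point_count_def)
    qed
    also have "\<dots> = (\<integral>\<^sup>+\<omega>. point_count X A \<omega> \<partial>M) * (\<integral>\<^sup>+\<omega>. indicator C' (?NY \<omega>) \<partial>M)"
      using nn_integral_indep_var_mult[OF iv2] A by (simp add: mult.commute)
    also have "(\<integral>\<^sup>+\<omega>. indicator C' (?NY \<omega>) \<partial>M) = (\<integral>\<^sup>+\<omega>. indicator C \<omega> \<partial>M)"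
      by (intro nn_integral_cong) (auto simp: CC' indicator_def)
    also have "\<dots> = emeasure MF C"
    proof -
      have "C \<subseteq> space M" using sets.sets_into_space[OF C] by simp
      moreover from this have "C \<in> sets M" using measurable_sets[OF sub C] by (simp add: Int_absorb2)
      ultimately show ?thesis
        unfolding MF_def using sub by (subst emeasure_distr) (auto simp: Int_absorb2)
    qed
    also have "(\<integral>\<^sup>+\<omega>. point_count X A \<omega> \<partial>M) = emeasure (density lborel (\<lambda>_. ennreal lam)) A"
      using A by (simp add: poisson_mean_count[OF X lam] emeasure_density_const)
    finally show "emeasure (density lborel (\<lambda>_. ennreal lam)) A * emeasure MF C = emeasure D (A \<times> C)" ..
  qed
  note DD = this[symmetric]
  have Z'[measurable]: "Z \<in> borel_measurable (lborel \<Otimes>\<^sub>M MF)" 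
    using Z by (simp add: MF_def cong: measurable_cong_sets sets_pair_measure_cong)
  have Zx: "(\<lambda>\<omega>. Z (x, \<omega>)) \<in> borel_measurable ?F" for x
    using Z by simp
  have "(\<integral>\<^sup>+\<omega>. (\<Sum>m. Z (X m \<omega>, \<omega>)) \<partial>M) = (\<integral>\<^sup>+z. Z z \<partial>D)" using nnD[OF Z] ..
  also have "\<dots> = (\<integral>\<^sup>+x. \<integral>\<^sup>+\<omega>. Z (x, \<omega>) \<partial>MF \<partial>density lborel (\<lambda>_. ennreal lam))"
    unfolding DD using Z' by (subst MF.nn_integral_fst[symmetric]) (auto cong: measurable_cong_sets sets_pair_measure_cong)
  also have "\<dots> = (\<integral>\<^sup>+x. ennreal lam * (\<integral>\<^sup>+\<omega>. Z (x, \<omega>) \<partial>MF) \<partial>lborel)"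
    using MF.borel_measurable_nn_integral_fst[OF Z'] by (subst nn_integral_density) auto
  also have "\<dots> = ennreal lam * (\<integral>\<^sup>+x. \<integral>\<^sup>+\<omega>. Z (x, \<omega>) \<partial>MF \<partial>lborel)"
    using MF.borel_measurable_nn_integral_fst[OF Z'] by (intro nn_integral_cmult) auto
  also have "(\<lambda>x. \<integral>\<^sup>+\<omega>. Z (x, \<omega>) \<partial>MF) = (\<lambda>x. \<integral>\<^sup>+\<omega>. Z (x, \<omega>) \<partial>M)"
    unfolding MF_def using Zx by (subst nn_integral_distr[OF sub]) auto
  finally show ?thesis .
qed

section \<open>Averaging over the fading\<close>

text \<open>
  The exponent \<open>w = - ln (1 - v)\<close> of the survival probability \<open>1 - v\<close>, infinite for \<open>v = 1\<close>.
\<close>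

definition minus_log_compl :: "real \<Rightarrow> ennreal"
  where "minus_log_compl v = (if v < 1 then ennreal (- ln (1 - v)) else \<top>)"

lemma exp_minus_minus_log_compl:
  assumes "0 \<le> v" "v \<le> 1"
  shows "exp_minus (minus_log_compl v) = ennreal (1 - v)"
proof (cases "v = 1")
  case False
  then have "0 \<le> - ln (1 - v)" using assms by (simp add: ln_le_zero_iff)
  then show ?thesis using assms False by (simp add: minus_log_compl_def exp_minus_ennreal)
qed (simp add: minus_log_compl_def)

lemma minus_log_compl_measurable [measurable]: "minus_log_compl \<in> borel_measurable borel"
  unfolding minus_log_compl_def by measurable

text \<open>
  The fading is independent of the locations, so it can be integrated out with the locations kept
  fixed. Of the whole family only the variables at the user \<open>m\<close> matter: reindexing by \<open>\<sigma>\<close> puts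
  the one towards the origin in front of the sequence of those towards the other stations, and the
  law of an i.i.d. sequence splits into head and tail.
\<close>

lemma (in prob_space) nn_integral_fading_given_locations:
  fixes h :: "nat option \<Rightarrow> nat \<Rightarrow> 'a \<Rightarrow> real" and Y X :: "nat \<Rightarrow> 'a \<Rightarrow> 'b::euclidean_space"
  assumes ind: "independent_fading M h Y X" and Q: "\<And>i m. distr M borel (h i m) = Q"
    and [measurable]: "\<And>n. Y n \<in> borel_measurable M" "\<And>n. X n \<in> borel_measurable M"
    and \<Psi>[measurable]: "\<Psi> \<in> borel_measurable (borel \<Otimes>\<^sub>M (Pi\<^sub>M UNIV (\<lambda>_. borel) \<Otimes>\<^sub>M Pi\<^sub>M UNIV (\<lambda>_. borel)))"
  shows "(\<integral>\<^sup>+\<omega>. \<Psi> (h None m \<omega>, \<lambda>n. h (Some n) m \<omega>, \<lambda>n. (Y n \<omega>, X n \<omega>)) \<partial>M) =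
    (\<integral>\<^sup>+\<omega>. \<integral>\<^sup>+t. \<integral>\<^sup>+\<eta>. \<Psi> (t, \<eta>, \<lambda>n. (Y n \<omega>, X n \<omega>)) \<partial>Pi\<^sub>M UNIV (\<lambda>_. Q) \<partial>Q \<partial>M)"
proof -
  let ?PH = "Pi\<^sub>M (UNIV :: (nat option \<times> nat) set) (\<lambda>_. borel :: real measure)"
  let ?PL = "Pi\<^sub>M (UNIV :: nat set) (\<lambda>_. borel :: ('b \<times> 'b) measure)"
  let ?S = "Pi\<^sub>M (UNIV :: nat set) (\<lambda>_. Q)"
  define hf where "hf = (\<lambda>\<omega> (i, m). h i m \<omega>)"
  define loc where "loc = (\<lambda>\<omega> n. (Y n \<omega>, X n \<omega>))"
  have iv: "indep_vars (\<lambda>_. borel) (\<lambda>(i, m). h i m) UNIV"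
    using ind by (simp add: independent_fading_def)
  have hm[measurable]: "h i m \<in> borel_measurable M" for i m
    using iv unfolding indep_vars_def by (metis UNIV_I case_prod_conv)
  have hf: "hf \<in> M \<rightarrow>\<^sub>M ?PH"
    unfolding hf_def by (rule measurable_PiM_single') (auto simp: split_beta')
  have loc: "loc \<in> M \<rightarrow>\<^sub>M ?PL"
    unfolding loc_def by (rule measurable_PiM_single') (auto simp: space_pair_measure simp flip: borel_prod)
  have pQ: "prob_space Q" using prob_space_distr[OF hm[of None 0]] by (simp add: Q)
  have sQ[measurable_cong]: "sets Q = sets borel" using Q[of None 0] by (metis sets_distr)
  interpret S: product_prob_space "\<lambda>_::nat. Q" UNIV
    by (rule product_prob_spaceI) (rule pQ)
  interpret S': sequence_space Q ..
  interpret Q: prob_space Q by (rule pQ)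
  define DH where "DH = Pi\<^sub>M (UNIV :: (nat option \<times> nat) set) (\<lambda>_. Q)"
  interpret DH: prob_space DH unfolding DH_def by (rule prob_space_PiM) (rule pQ)
  have sDH[measurable_cong]: "sets DH = sets ?PH"
    unfolding DH_def by (intro sets_PiM_cong) (auto simp: sQ)
  have sS[measurable_cong]: "sets ?S = sets (Pi\<^sub>M UNIV (\<lambda>_. borel))"
    by (intro sets_PiM_cong) (auto simp: sQ)
  have dH: "distr M ?PH hf = DH"
  proof -
    have "distr M ?PH (\<lambda>x. \<lambda>p\<in>UNIV. (case p of (i, m) \<Rightarrow> h i m) x) =
        Pi\<^sub>M UNIV (\<lambda>p. distr M borel (case p of (i, m) \<Rightarrow> h i m))"
      by (rule iffD1[OF indep_vars_iff_distr_eq_PiM iv]) (auto simp: split_beta')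
    moreover have "(\<lambda>x. \<lambda>p\<in>UNIV. (case p of (i, m) \<Rightarrow> h i m) x) = hf"
      by (auto simp: hf_def fun_eq_iff)
    moreover have "(\<lambda>p. distr M borel (case p of (i, m) \<Rightarrow> h i m)) = (\<lambda>_. Q)"
      by (auto simp: fun_eq_iff Q)
    ultimately show ?thesis by (simp add: DH_def)
  qed
  have ind2: "indep_set (sets (vimage_algebra (space M) hf ?PH)) (sets (vimage_algebra (space M) loc ?PL))"
    using ind by (simp add: independent_fading_def hf_def loc_def)
  interpret L: prob_space "distr M ?PL loc" by (rule prob_space_distr[OF loc])
  interpret pair_sigma_finite DH "distr M ?PL loc" ..
  have joint: "DH \<Otimes>\<^sub>M distr M ?PL loc = distr M (?PH \<Otimes>\<^sub>M ?PL) (\<lambda>\<omega>. (hf \<omega>, loc \<omega>))"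
  proof (rule pair_measure_eqI)
    show "sigma_finite_measure DH" "sigma_finite_measure (distr M ?PL loc)" ..
    show "sets (DH \<Otimes>\<^sub>M distr M ?PL loc) = sets (distr M (?PH \<Otimes>\<^sub>M ?PL) (\<lambda>\<omega>. (hf \<omega>, loc \<omega>)))"
      by (simp add: sDH cong: sets_pair_measure_cong)
    fix A B assume "A \<in> sets DH" "B \<in> sets (distr M ?PL loc)"
    then have A: "A \<in> sets ?PH" and B: "B \<in> sets ?PL" by (simp_all add: sDH)
    have "hf -` A \<inter> space M \<in> sets (vimage_algebra (space M) hf ?PH)"
      "loc -` B \<inter> space M \<in> sets (vimage_algebra (space M) loc ?PL)"
      using A B by (auto intro!: in_vimage_algebra)
    from indep_setD[OF ind2 this]
    have "emeasure M ((hf -` A \<inter> space M) \<inter> (loc -` B \<inter> space M)) =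
        emeasure M (hf -` A \<inter> space M) * emeasure M (loc -` B \<inter> space M)"
      by (simp add: emeasure_eq_measure ennreal_mult)
    moreover have "(\<lambda>\<omega>. (hf \<omega>, loc \<omega>)) -` (A \<times> B) \<inter> space M = (hf -` A \<inter> space M) \<inter> (loc -` B \<inter> space M)"
      by auto
    ultimately show "emeasure DH A * emeasure (distr M ?PL loc) B =
        emeasure (distr M (?PH \<Otimes>\<^sub>M ?PL) (\<lambda>\<omega>. (hf \<omega>, loc \<omega>))) (A \<times> B)"
      unfolding dH[symmetric] using hf loc A B by (simp add: emeasure_distr)
  qed
  define g where "g = (\<lambda>(\<eta>, l). \<Psi> (\<eta> (None, m), \<lambda>n. \<eta> (Some n, m), l))"
  have sel[measurable]: "(\<lambda>\<eta> n. \<eta> (Some n, m)) \<in> ?PH \<rightarrow>\<^sub>M Pi\<^sub>M UNIV (\<lambda>_. borel)"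
    by (rule measurable_PiM_single') auto
  have g[measurable]: "g \<in> borel_measurable (?PH \<Otimes>\<^sub>M ?PL)"
    unfolding g_def by measurable
  have inner: "(\<integral>\<^sup>+\<eta>. g (\<eta>, l) \<partial>DH) = (\<integral>\<^sup>+t. \<integral>\<^sup>+\<eta>. \<Psi> (t, \<eta>, l) \<partial>?S \<partial>Q)" for l
  proof -
    define \<sigma> where "\<sigma> = case_nat (None, m) (\<lambda>n. (Some n, m))"
    define g' where "g' \<zeta> = \<Psi> (\<zeta> 0, \<lambda>n. \<zeta> (Suc n), l)" for \<zeta> :: "nat \<Rightarrow> real"
    have [measurable]: "(\<lambda>\<zeta> n. \<zeta> (Suc n)) \<in> Pi\<^sub>M UNIV (\<lambda>_. borel) \<rightarrow>\<^sub>M Pi\<^sub>M UNIV (\<lambda>_. borel :: real measure)"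
      by (rule measurable_PiM_single') auto
    have l: "l \<in> space ?PL" by (simp add: space_PiM)
    have g'[measurable]: "g' \<in> borel_measurable (Pi\<^sub>M UNIV (\<lambda>_. borel))"
      unfolding g'_def using l by measurable
    have g'S: "g' \<in> borel_measurable ?S" by measurable
    have "inj \<sigma>" by (auto simp: inj_on_def \<sigma>_def split: nat.splits)
    then have r: "distr DH ?S (\<lambda>\<omega>. \<lambda>n\<in>UNIV. \<omega> (\<sigma> n)) = ?S"
      unfolding DH_def using pQ by (intro distr_PiM_reindex) auto
    have rm: "(\<lambda>\<omega>. \<lambda>n\<in>UNIV. \<omega> (\<sigma> n)) \<in> DH \<rightarrow>\<^sub>M ?S"
      unfolding DH_def by (intro measurable_restrict) simp
    have "(\<integral>\<^sup>+\<eta>. g (\<eta>, l) \<partial>DH) = (\<integral>\<^sup>+\<eta>. g' (\<lambda>n\<in>UNIV. \<eta> (\<sigma> n)) \<partial>DH)"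
      by (simp add: g_def g'_def \<sigma>_def)
    also have "\<dots> = (\<integral>\<^sup>+\<zeta>. g' \<zeta> \<partial>distr DH ?S (\<lambda>\<omega>. \<lambda>n\<in>UNIV. \<omega> (\<sigma> n)))"
      by (rule nn_integral_distr[OF rm, symmetric]) (simp add: g'S)
    also have "\<dots> = (\<integral>\<^sup>+\<zeta>. g' \<zeta> \<partial>distr (Q \<Otimes>\<^sub>M ?S) ?S (\<lambda>(s, \<omega>). case_nat s \<omega>))"
      unfolding r S'.PiM_iter ..
    also have "\<dots> = (\<integral>\<^sup>+z. g' (case z of (s, \<omega>) \<Rightarrow> case_nat s \<omega>) \<partial>(Q \<Otimes>\<^sub>M ?S))"
      by (rule nn_integral_distr) (auto simp: g'S)
    also have "\<dots> = (\<integral>\<^sup>+t. \<integral>\<^sup>+\<eta>. \<Psi> (t, \<eta>, l) \<partial>?S \<partial>Q)"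
      using l by (subst S.P.nn_integral_fst[symmetric]) (auto simp: g'_def split_beta')
    finally show ?thesis .
  qed
  have "(\<integral>\<^sup>+\<omega>. \<Psi> (h None m \<omega>, \<lambda>n. h (Some n) m \<omega>, \<lambda>n. (Y n \<omega>, X n \<omega>)) \<partial>M) =
      (\<integral>\<^sup>+\<omega>. g (hf \<omega>, loc \<omega>) \<partial>M)"
    by (simp add: g_def hf_def loc_def)
  also have "\<dots> = (\<integral>\<^sup>+z. g z \<partial>(DH \<Otimes>\<^sub>M distr M ?PL loc))"
    unfolding joint using hf loc by (subst nn_integral_distr) auto
  also have "\<dots> = (\<integral>\<^sup>+l. \<integral>\<^sup>+\<eta>. g (\<eta>, l) \<partial>DH \<partial>distr M ?PL loc)"
    by (rule nn_integral_snd[symmetric]) (simp cong: measurable_cong_sets sets_pair_measure_cong add: sDH)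
  also have "\<dots> = (\<integral>\<^sup>+\<omega>. \<integral>\<^sup>+\<eta>. g (\<eta>, loc \<omega>) \<partial>DH \<partial>M)"
    by (rule nn_integral_distr[OF loc]) measurable
  finally show ?thesis by (simp add: inner loc_def)
qed

text \<open>
  Here \<open>l0\<close> and \<open>l n\<close> are the path losses from the origin and from the \<open>n\<close>-th station. Being
  strictly below the infimum of infinitely many values is not a product event, but being at most
  the infimum is. The two differ by a tie, which is a null event because \<open>Q\<close> has no atoms.
\<close>

lemma nn_integral_served_given_locations:
  fixes Q :: "real measure" and l :: "nat \<Rightarrow> real" and \<phi> :: "real \<Rightarrow> ennreal"
  assumes "prob_space Q" and sQ[measurable_cong]: "sets Q = sets borel"
    and atomless: "\<And>a. emeasure Q {a} = 0" and pos: "emeasure Q {..0} = 0"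
    and l0: "0 < l0" and l: "\<And>n. 0 < l n" and \<phi>[measurable]: "\<phi> \<in> borel_measurable borel"
  shows "(\<integral>\<^sup>+t. \<integral>\<^sup>+\<eta>. (if inverse (ennreal (t * l0)) < (INF n. inverse (ennreal (\<eta> n * l n))) then \<phi> t else 0)
      \<partial>Pi\<^sub>M UNIV (\<lambda>_. Q) \<partial>Q) =
    (\<integral>\<^sup>+t. \<phi> t * exp_minus (\<Sum>n. minus_log_compl (measure Q {t * l0 / l n..})) \<partial>Q)"
proof -
  let ?S = "Pi\<^sub>M (UNIV :: nat set) (\<lambda>_. Q)"
  interpret Q: prob_space Q by fact
  interpret S: product_prob_space "\<lambda>_::nat. Q" UNIV
    by (rule product_prob_spaceI) (rule assms(1))
  interpret S': sequence_space Q ..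
  interpret pair_sigma_finite Q ?S ..
  have spQ: "space Q = UNIV" using sQ by (auto dest: sets_eq_imp_space_eq)
  have sS[measurable_cong]: "sets ?S = sets (Pi\<^sub>M UNIV (\<lambda>_. borel))"
    by (intro sets_PiM_cong) (auto simp: sQ)
  let ?c = "\<lambda>\<eta>::nat \<Rightarrow> real. INF n. inverse (ennreal (\<eta> n * l n))"
  have tpos: "AE t in Q. 0 < t"
    using pos by (intro AE_I[of _ _ "{..0}"]) (auto simp: sQ)
  have "AE t in Q. inverse (ennreal (t * l0)) \<noteq> ?c \<eta>" for \<eta>
  proof -
    have "AE t in Q. t \<noteq> inverse (l0 * enn2real (?c \<eta>))"
      by (intro AE_I[of _ _ "{inverse (l0 * enn2real (?c \<eta>))}"]) (auto simp: sQ atomless)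
    with tpos show ?thesis
    proof eventually_elim
      case (elim t)
      then have t: "0 < t * l0" using l0 by simp
      show ?case
      proof
        assume "inverse (ennreal (t * l0)) = ?c \<eta>"
        then have "enn2real (?c \<eta>) = inverse (t * l0)"
          using t by (metis enn2real_ennreal inverse_ennreal less_imp_le positive_imp_inverse_positive)
        then have "t \<noteq> inverse (l0 * inverse (t * l0))" using elim by simp
        then show False using elim(1) l0 by (simp add: field_simps)
      qed
    qed
  qed
  then have "AE \<eta> in ?S. AE t in Q. inverse (ennreal (t * l0)) \<noteq> ?c \<eta>" by simp
  then have ne: "AE t in Q. AE \<eta> in ?S. inverse (ennreal (t * l0)) \<noteq> ?c \<eta>"
  proof (rule AE_commute[THEN iffD2, rotated])
    show "{z \<in> space (Q \<Otimes>\<^sub>M ?S). inverse (ennreal (fst z * l0)) \<noteq> ?c (snd z)} \<in> sets (Q \<Otimes>\<^sub>M ?S)"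
      by (rule borel_measurable_neq) measurable
  qed
  show ?thesis
  proof (rule nn_integral_cong_AE, use ne tpos in eventually_elim)
    case (elim t)
    define a where "a n = t * l0 / l n" for n
    have tl: "0 < t * l0" using elim l0 by simp
    have inverse_le: "inverse (ennreal p) \<le> inverse (ennreal q) \<longleftrightarrow> q \<le> p" if "0 < p" "0 < q" for p q
      using that by (simp add: inverse_ennreal)
    have le: "inverse (ennreal (t * l0)) \<le> inverse (ennreal (w * l n)) \<longleftrightarrow> w \<le> a n" for w n
    proof (cases "0 < w")
      case True
      then have "0 < w * l n" using l by simp
      then have "inverse (ennreal (t * l0)) \<le> inverse (ennreal (w * l n)) \<longleftrightarrow> w * l n \<le> t * l0"
        using tl by (intro inverse_le)
      then show ?thesis using l[of n] by (simp add: a_def field_simps)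
    next
      case False
      then have "w * l n \<le> 0" using l[of n] by (simp add: mult_nonpos_nonneg)
      moreover have "0 < a n" using tl l[of n] by (simp add: a_def)
      ultimately show ?thesis using False by (simp add: ennreal_neg)
    qed
    have "(\<integral>\<^sup>+\<eta>. (if inverse (ennreal (t * l0)) < ?c \<eta> then \<phi> t else 0) \<partial>?S) =
        (\<integral>\<^sup>+\<eta>. \<phi> t * indicator (Pi UNIV (\<lambda>n. {..a n})) \<eta> \<partial>?S)"
    proof (rule nn_integral_cong_AE, use elim(1) in eventually_elim)
      case (elim \<eta>)
      then have "inverse (ennreal (t * l0)) < ?c \<eta> \<longleftrightarrow> inverse (ennreal (t * l0)) \<le> ?c \<eta>" by auto
      also have "\<dots> \<longleftrightarrow> \<eta> \<in> Pi UNIV (\<lambda>n. {..a n})" by (auto simp: le_INF_iff le)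
      finally show ?case by (simp add: indicator_def)
    qed
    also have "\<dots> = \<phi> t * emeasure ?S (Pi UNIV (\<lambda>n. {..a n}))"
      by (intro nn_integral_cmult_indicator S'.infprod_in_sets) (simp add: sQ)
    also have "emeasure ?S (Pi UNIV (\<lambda>n. {..a n})) =
        exp_minus (\<Sum>n. minus_log_compl (measure Q {a n..}))"
    proof -
      have c: "ennreal (measure Q {..a n}) = exp_minus (minus_log_compl (measure Q {a n..}))" for n
      proof -
        have "measure Q ({..a n} \<union> {a n..}) = measure Q {..a n} + measure Q {a n..} - measure Q ({..a n} \<inter> {a n..})"
          by (rule measure_Un3) (auto simp: fmeasurable_def sQ Q.emeasure_finite less_top[symmetric])
        moreover have "{..a n} \<union> {a n..} = space Q" "{..a n} \<inter> {a n..} = {a n}" by (auto simp: spQ)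
        ultimately have "measure Q {..a n} = 1 - measure Q {a n..}"
          using atomless[of "a n"] by (simp add: Q.prob_space measure_eq_0_null_sets null_sets_def sQ)
        then show ?thesis by (simp add: exp_minus_minus_log_compl)
      qed
      have "(\<lambda>N. \<Prod>n\<le>N. measure Q {..a n}) \<longlonglongrightarrow> measure ?S (Pi UNIV (\<lambda>n. {..a n}))"
        by (rule S'.measure_PiM_countable) (simp add: sQ)
      then have "(\<lambda>N. ennreal (\<Prod>n\<le>N. measure Q {..a n})) \<longlonglongrightarrow> emeasure ?S (Pi UNIV (\<lambda>n. {..a n}))"
        unfolding S.P.emeasure_eq_measure by (rule tendsto_ennrealI)
      moreover have "(\<lambda>N. ennreal (\<Prod>n\<le>N. measure Q {..a n})) \<longlonglongrightarrow>
          exp_minus (\<Sum>n. minus_log_compl (measure Q {a n..}))"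
        using LIMSEQ_Suc[OF exp_minus_suminf[of "\<lambda>n. minus_log_compl (measure Q {a n..})"]]
        by (simp add: lessThan_Suc_atMost c flip: prod_ennreal)
      ultimately show ?thesis by (rule LIMSEQ_unique)
    qed
    finally show ?case by (simp add: a_def)
  qed
qed

section \<open>The mean measure of the path loss fadings\<close>

lemma nn_integral_lborel_affine:
  fixes g :: "'a::euclidean_space \<Rightarrow> ennreal"
  assumes [measurable]: "g \<in> borel_measurable borel" and c: "\<bar>c\<bar> = 1"
  shows "(\<integral>\<^sup>+y. g (a + c *\<^sub>R y) \<partial>lborel) = (\<integral>\<^sup>+y. g y \<partial>lborel)"
proof -
  have "c \<noteq> 0" using c by auto
  from lborel_affine[OF this, of a]
  have "distr lborel borel (\<lambda>y. a + c *\<^sub>R y) = (lborel :: 'a measure)"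
    by (simp add: c density_1)
  then have "(\<integral>\<^sup>+y. g y \<partial>lborel) = (\<integral>\<^sup>+y. g y \<partial>distr lborel borel (\<lambda>y. a + c *\<^sub>R y))" by simp
  also have "\<dots> = (\<integral>\<^sup>+y. g (a + c *\<^sub>R y) \<partial>lborel)" by (rule nn_integral_distr) auto
  finally show ?thesis ..
qed

lemma measure_atLeast_measurable:
  fixes Q :: "real measure"
  assumes "finite_measure Q" and Q: "sets Q = sets borel"
  shows "(\<lambda>a. measure Q {a..}) \<in> borel_measurable borel"
proof -
  interpret finite_measure Q by fact
  have "mono (\<lambda>a. - measure Q {a..})"
    by (intro monoI) (auto intro!: finite_measure_mono simp: Q)
  then have "(\<lambda>a. - (- measure Q {a..})) \<in> borel_measurable borel"
    by (intro borel_measurable_uminus borel_measurable_mono)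
  then show ?thesis by simp
qed

text \<open>
  The mean measure of the path loss fadings seen from one location, for stations of unit intensity
  with fading of law \<open>Q\<close>.
\<close>

definition fading_intensity :: "real measure \<Rightarrow> ('a::euclidean_space \<Rightarrow> real) \<Rightarrow> real measure"
  where "fading_intensity Q L = distr (lborel \<Otimes>\<^sub>M Q) borel (\<lambda>(x, t). inverse (t * L x))"

locale fading_law = prob_space Q for Q :: "real measure" +
  fixes L :: "'a::euclidean_space \<Rightarrow> real"
  assumes sets_Q [measurable_cong]: "sets Q = sets borel"
    and ac_Q: "absolutely_continuous lborel Q"
    and pos_Q: "emeasure Q {..0} = 0"
    and L_measurable [measurable]: "L \<in> borel_measurable borel"
    and L_pos: "0 < L z"
begin

abbreviation \<mu> where "\<mu> \<equiv> fading_intensity Q L"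

lemma space_Q [simp]: "space Q = UNIV"
  using sets_eq_imp_space_eq[OF sets_Q] by simp

lemma AE_Q_pos: "AE t in Q. 0 < t"
  using pos_Q by (intro AE_I[of _ _ "{..0}"]) (auto simp: sets_Q)

lemma null_Q: "A \<in> null_sets lborel \<Longrightarrow> emeasure Q A = 0"
  using ac_Q by (auto simp: absolutely_continuous_def)

lemma sets_fading_intensity [measurable_cong, simp]: "sets \<mu> = sets borel"
  by (simp add: fading_intensity_def)

lemma nn_integral_fading_intensity:
  assumes [measurable]: "g \<in> borel_measurable borel"
  shows "(\<integral>\<^sup>+\<beta>. g \<beta> \<partial>\<mu>) = (\<integral>\<^sup>+x. \<integral>\<^sup>+t. g (inverse (t * L x)) \<partial>Q \<partial>lborel)"
  unfolding fading_intensity_def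
  by (subst nn_integral_distr, measurable, subst nn_integral_fst[symmetric]) (auto simp: split_beta')

lemma emeasure_fading_intensity:
  assumes [measurable]: "A \<in> sets borel"
  shows "emeasure \<mu> A = (\<integral>\<^sup>+x. emeasure Q {t. inverse (t * L x) \<in> A} \<partial>lborel)"
proof -
  have "emeasure \<mu> A = (\<integral>\<^sup>+\<beta>. indicator A \<beta> \<partial>\<mu>)" by simp
  also have "\<dots> = (\<integral>\<^sup>+x. \<integral>\<^sup>+t. indicator A (inverse (t * L x)) \<partial>Q \<partial>lborel)"
    by (rule nn_integral_fading_intensity) simp
  also have "\<dots> = (\<integral>\<^sup>+x. emeasure Q {t. inverse (t * L x) \<in> A} \<partial>lborel)"
  proof (rule nn_integral_cong)
    fix x
    have "{t \<in> space Q. inverse (t * L x) \<in> A} \<in> sets Q" by measurable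
    then have "emeasure Q {t. inverse (t * L x) \<in> A} = (\<integral>\<^sup>+t. indicator {t. inverse (t * L x) \<in> A} t \<partial>Q)"
      by simp
    then show "(\<integral>\<^sup>+t. indicator A (inverse (t * L x)) \<partial>Q) = emeasure Q {t. inverse (t * L x) \<in> A}"
      by (simp add: indicator_def)
  qed
  finally show ?thesis .
qed

text \<open>
  The right-hand side is \<open>B(\<beta>)\<close>.
\<close>

lemma fading_intensity_atMost:
  assumes \<beta>: "0 < \<beta>"
  shows "emeasure \<mu> {..\<beta>} = (\<integral>\<^sup>+x. ennreal (measure Q {inverse (L x * \<beta>)..}) \<partial>lborel)"
proof -
  have "emeasure Q {t. inverse (t * L x) \<in> {..\<beta>}} = ennreal (measure Q {inverse (L x * \<beta>)..})" for x
  proof -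
    have "emeasure Q {t. inverse (t * L x) \<in> {..\<beta>}} = emeasure Q {inverse (L x * \<beta>)..}"
    proof (rule emeasure_eq_AE, use AE_Q_pos in eventually_elim)
      case (elim t)
      then have "inverse (t * L x) \<le> \<beta> \<longleftrightarrow> inverse (L x * \<beta>) \<le> t"
        using L_pos[of x] \<beta> by (simp add: field_simps)
      then show ?case by simp
    next
      have "{t \<in> space Q. inverse (t * L x) \<in> {..\<beta>}} \<in> sets Q" by measurable
      then show "{t. inverse (t * L x) \<in> {..\<beta>}} \<in> sets Q" by simp
    qed (simp add: sets_Q)
    then show ?thesis by (simp add: emeasure_eq_measure)
  qed
  then show ?thesis by (simp add: emeasure_fading_intensity)
qed

lemma fading_intensity_nonpos: "emeasure \<mu> {..0} = 0"
proof -
  have "emeasure Q {t. inverse (t * L x) \<in> {..0}} = 0" for x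
  proof -
    have "emeasure Q {t. inverse (t * L x) \<in> {..0}} = emeasure Q {..0}"
      using L_pos[of x] by (intro arg_cong[of _ _ "emeasure Q"]) (auto simp: mult_le_0_iff)
    then show ?thesis by (simp add: pos_Q)
  qed
  then show ?thesis by (simp add: emeasure_fading_intensity)
qed

text \<open>
  For fixed \<open>x\<close> the map \<open>s \<mapsto> 1 / (s L(x))\<close> is its own inverse and differentiable away from \<open>0\<close>, so
  it carries null sets to null sets, and \<open>Q\<close> does not charge these.
\<close>

lemma absolutely_continuous_fading_intensity: "absolutely_continuous lborel \<mu>"
  unfolding absolutely_continuous_def
proof
  fix A :: "real set" assume A: "A \<in> null_sets lborel"
  then have [measurable]: "A \<in> sets borel" by auto
  have "emeasure Q {t. inverse (t * L x) \<in> A} = 0" for x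
  proof -
    let ?N = "{t. inverse (t * L x) \<in> A} - {0}"
    have "{t \<in> space borel. inverse (t * L x) \<in> A} - {0} \<in> sets borel" by measurable
    then have N: "?N \<in> sets borel" by simp
    have "A \<in> null_sets lebesgue" using A by (rule null_sets_completionI)
    then have "negligible (A - {0})" by (intro negligible_diff) (simp add: negligible_iff_null_sets)
    then have "negligible ((\<lambda>s. inverse (s * L x)) ` (A - {0}))"
    proof (rule negligible_differentiable_image_negligible[OF order_refl])
      show "(\<lambda>s. inverse (s * L x)) differentiable_on A - {0}"
        unfolding differentiable_on_def using L_pos[of x]
        by (auto intro!: derivative_intros simp: less_imp_neq[symmetric])
    qed
    moreover have "?N \<subseteq> (\<lambda>s. inverse (s * L x)) ` (A - {0})"
    proof
      fix t assume t: "t \<in> ?N"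
      have "t = inverse (inverse (t * L x) * L x)" using L_pos[of x] by simp
      moreover have "inverse (t * L x) \<in> A - {0}" using t L_pos[of x] by simp
      ultimately show "t \<in> (\<lambda>s. inverse (s * L x)) ` (A - {0})" by blast
    qed
    ultimately have "negligible ?N" by (rule negligible_subset)
    then have "?N \<in> null_sets lborel"
      using N by (simp add: negligible_iff_null_sets null_sets_completion_iff)
    then have "emeasure Q ?N = 0" by (rule null_Q)
    moreover have "emeasure Q {0} = 0" by (rule null_Q) (simp add: null_sets_def)
    ultimately have "emeasure Q (?N \<union> {0}) = 0"
      using emeasure_subadditive[of ?N Q "{0}"] N by (simp add: sets_Q)
    moreover have "emeasure Q {t. inverse (t * L x) \<in> A} \<le> emeasure Q (?N \<union> {0})"
      using N by (intro emeasure_mono) (auto simp: sets_Q)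
    ultimately show ?thesis by simp
  qed
  then show "A \<in> null_sets \<mu>" by (intro null_setsI) (simp_all add: emeasure_fading_intensity)
qed

text \<open>
  For stations of unit intensity, the mean number of those that prevent the origin from serving a
  user at \<open>x\<close> with fading \<open>t\<close>. By translation invariance it depends on \<open>x\<close> and \<open>t\<close> through the path
  loss fading \<open>1 / (t L(-x))\<close> only.
\<close>

lemma nn_integral_shifted_ccdf:
  assumes t: "0 < t"
  shows "(\<integral>\<^sup>+y. ennreal (measure Q {t * L (- x) / L (y - x)..}) \<partial>lborel) = emeasure \<mu> {..inverse (t * L (- x))}"
proof -
  define \<beta> where "\<beta> = inverse (t * L (- x))"
  have \<beta>: "0 < \<beta>" using t L_pos[of "- x"] by (simp add: \<beta>_def)
  have [measurable]: "(\<lambda>a. measure Q {a..}) \<in> borel_measurable borel"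
    by (rule measure_atLeast_measurable) (auto simp: sets_Q finite_measure_axioms)
  have "t * L (- x) / L (y - x) = inverse (L ((- x) + 1 *\<^sub>R y) * \<beta>)" for y
    by (simp add: \<beta>_def field_simps)
  then have "(\<integral>\<^sup>+y. ennreal (measure Q {t * L (- x) / L (y - x)..}) \<partial>lborel) =
      (\<integral>\<^sup>+y. ennreal (measure Q {inverse (L ((- x) + 1 *\<^sub>R y) * \<beta>)..}) \<partial>lborel)" by simp
  also have "\<dots> = (\<integral>\<^sup>+y. ennreal (measure Q {inverse (L y * \<beta>)..}) \<partial>lborel)"
    by (rule nn_integral_lborel_affine[of "\<lambda>y. ennreal (measure Q {inverse (L y * \<beta>)..})"]) auto
  also have "\<dots> = emeasure \<mu> {..\<beta>}" by (rule fading_intensity_atMost[OF \<beta>, symmetric])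
  finally show ?thesis unfolding \<beta>_def .
qed

end

section \<open>The mean cell capacity\<close>

lemma capacity_function_measurable:
  assumes f: "capacity_function f"
  shows "(\<lambda>\<beta>. ennreal (f \<beta>) * indicator {0<..} \<beta>) \<in> borel_measurable borel"
proof -
  have "f \<in> borel_measurable (restrict_space borel {0<..})" using f by (simp add: capacity_function_def)
  then have "(\<lambda>\<beta>. f \<beta> * indicator {0<..} \<beta>) \<in> borel_measurable borel"
    by (subst (asm) borel_measurable_restrict_space_iff) (auto simp: mult.commute)
  then have "(\<lambda>\<beta>. ennreal (f \<beta> * indicator {0<..} \<beta>)) \<in> borel_measurable borel" by measurable
  moreover have "ennreal (f \<beta> * indicator {0<..} \<beta>) = ennreal (f \<beta>) * indicator {0<..} \<beta>" for \<beta>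
    by (simp add: indicator_def)
  ultimately show ?thesis by simp
qed

context fading_law begin

lemma fading_intensity_atMost_measurable: "(\<lambda>\<beta>. emeasure \<mu> {..\<beta>}) \<in> borel_measurable borel"
proof -
  have [measurable]: "(\<lambda>a. measure Q {a..}) \<in> borel_measurable borel"
    by (rule measure_atLeast_measurable) (auto simp: sets_Q finite_measure_axioms)
  have "emeasure \<mu> {..\<beta>} =
      indicator {0<..} \<beta> * (\<integral>\<^sup>+x. ennreal (measure Q {inverse (L x * \<beta>)..}) \<partial>lborel)" for \<beta>
  proof (cases "0 < \<beta>")
    case False
    then have "emeasure \<mu> {..\<beta>} \<le> emeasure \<mu> {..0}" by (intro emeasure_mono) auto
    then show ?thesis using False by (simp add: fading_intensity_nonpos)
  qed (simp add: fading_intensity_atMost)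
  then show ?thesis by simp
qed

lemma nn_integral_served_sum:
  fixes y :: "nat \<Rightarrow> 'a" and \<phi> :: "real \<Rightarrow> ennreal"
  assumes \<phi>[measurable]: "\<phi> \<in> borel_measurable borel"
  shows "(\<integral>\<^sup>+t. \<integral>\<^sup>+\<eta>. (if inverse (ennreal (t * L (0 - x))) < (INF n. inverse (ennreal (\<eta> n * L (y n - x))))
        then \<phi> (enn2real (inverse (ennreal (t * L (0 - x))))) else 0) \<partial>Pi\<^sub>M UNIV (\<lambda>_. Q) \<partial>Q) =
    (\<integral>\<^sup>+t. \<phi> (inverse (t * L (- x))) *
      exp_minus (\<Sum>n. minus_log_compl (measure Q {t * L (- x) / L (y n - x)..})) \<partial>Q)"
proof -
  have "(\<integral>\<^sup>+t. \<integral>\<^sup>+\<eta>. (if inverse (ennreal (t * L (0 - x))) < (INF n. inverse (ennreal (\<eta> n * L (y n - x))))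
        then \<phi> (enn2real (inverse (ennreal (t * L (0 - x))))) else 0) \<partial>Pi\<^sub>M UNIV (\<lambda>_. Q) \<partial>Q) =
    (\<integral>\<^sup>+t. \<phi> (enn2real (inverse (ennreal (t * L (0 - x))))) *
      exp_minus (\<Sum>n. minus_log_compl (measure Q {t * L (0 - x) / L (y n - x)..})) \<partial>Q)"
    using pos_Q L_pos null_Q
    by (intro nn_integral_served_given_locations) (auto simp: sets_Q prob_space_axioms null_sets_def)
  also have "\<dots> = (\<integral>\<^sup>+t. \<phi> (inverse (t * L (- x))) *
      exp_minus (\<Sum>n. minus_log_compl (measure Q {t * L (- x) / L (y n - x)..})) \<partial>Q)"
  proof (rule nn_integral_cong_AE, use AE_Q_pos in eventually_elim)
    case (elim t)
    then have "0 < t * L (- x)" using L_pos[of "- x"] by simp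
    then show ?case by (simp add: inverse_ennreal del: inverse_mult_distrib)
  qed
  finally show ?thesis .
qed

end

text \<open>
  Restricting \<open>f\<close> to the positive half-line makes it a Borel function \<open>\<phi>\<close> without changing the cell
  capacity, since a served user has a path loss fading in \<open>(0, \<infinity>)\<close>.
\<close>

lemma (in prob_space) mean_cell_capacity_sum_over_users:
  fixes Y X :: "nat \<Rightarrow> 'a \<Rightarrow> 'b::euclidean_space"
  assumes "fading_law Q L"
    and [measurable]: "\<And>n. Y n \<in> borel_measurable M" "\<And>n. X n \<in> borel_measurable M"
    and Q: "\<And>i m. distr M borel (h i m) = Q" and ind: "independent_fading M h Y X"
    and f: "capacity_function f"
  defines "\<phi> \<equiv> (\<lambda>\<beta>. ennreal (f \<beta>) * indicator {0<..} \<beta>)"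
  shows "mean_cell_capacity M L h Y X f =
    (\<Sum>m. \<integral>\<^sup>+\<omega>. \<integral>\<^sup>+t. \<phi> (inverse (t * L (- X m \<omega>))) *
      exp_minus (\<Sum>n. minus_log_compl (measure Q {t * L (- X m \<omega>) / L (Y n \<omega> - X m \<omega>)..})) \<partial>Q \<partial>M)"
proof -
  interpret Q: fading_law Q L by fact
  have \<phi>[measurable]: "\<phi> \<in> borel_measurable borel"
    unfolding \<phi>_def by (rule capacity_function_measurable[OF f])
  have [measurable]: "h i m \<in> borel_measurable M" for i m
    using ind unfolding independent_fading_def indep_vars_def by (metis UNIV_I case_prod_conv)
  define \<Psi> where "\<Psi> m = (\<lambda>(t, \<eta>, l).
      if inverse (ennreal (t * L (0 - snd (l m)))) < (INF n. inverse (ennreal (\<eta> n * L (fst (l n) - snd (l m)))))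
      then \<phi> (enn2real (inverse (ennreal (t * L (0 - snd (l m)))))) else 0)"
    for m :: nat and t :: real and \<eta> :: "nat \<Rightarrow> real" and l :: "nat \<Rightarrow> 'b \<times> 'b"
  have \<Psi>: "\<Psi> m \<in> borel_measurable (borel \<Otimes>\<^sub>M (Pi\<^sub>M UNIV (\<lambda>_. borel) \<Otimes>\<^sub>M Pi\<^sub>M UNIV (\<lambda>_. borel)))" for m
    unfolding \<Psi>_def borel_prod[symmetric] by measurable
  have summand: "(if path_loss_fading L h Y X None m \<omega> < min_path_loss_fading L h Y X m \<omega>
          then ennreal (f (enn2real (path_loss_fading L h Y X None m \<omega>))) else 0) =
      \<Psi> m (h None m \<omega>, \<lambda>n. h (Some n) m \<omega>, \<lambda>n. (Y n \<omega>, X n \<omega>))" for m \<omega>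
  proof -
    let ?s = "path_loss_fading L h Y X None m \<omega>"
    have s: "?s = inverse (ennreal (h None m \<omega> * L (0 - X m \<omega>)))"
      by (simp add: path_loss_fading_def station_def)
    have "ennreal (f (enn2real ?s)) = \<phi> (enn2real ?s)" if "?s < min_path_loss_fading L h Y X m \<omega>"
    proof -
      have "?s < \<top>" using that by (rule order_less_le_trans) simp
      moreover have "?s \<noteq> 0" unfolding s by simp
      ultimately have "0 < enn2real ?s" by (simp add: enn2real_positive_iff zero_less_iff_neq_zero)
      then show ?thesis by (simp add: \<phi>_def)
    qed
    then show ?thesis
      by (auto simp: \<Psi>_def min_path_loss_fading_def path_loss_fading_def station_def)
  qed
  have meas: "(\<lambda>\<omega>. \<Psi> m (h None m \<omega>, \<lambda>n. h (Some n) m \<omega>, \<lambda>n. (Y n \<omega>, X n \<omega>))) \<in> borel_measurable M" for m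
  proof (rule measurable_compose[OF _ \<Psi>])
    show "(\<lambda>\<omega>. (h None m \<omega>, \<lambda>n. h (Some n) m \<omega>, \<lambda>n. (Y n \<omega>, X n \<omega>)))
        \<in> M \<rightarrow>\<^sub>M borel \<Otimes>\<^sub>M (Pi\<^sub>M UNIV (\<lambda>_. borel) \<Otimes>\<^sub>M Pi\<^sub>M UNIV (\<lambda>_. borel))"
      by (intro measurable_Pair measurable_PiM_single')
        (auto simp: space_pair_measure simp flip: borel_prod)
  qed
  have "mean_cell_capacity M L h Y X f =
      (\<Sum>m. \<integral>\<^sup>+\<omega>. \<Psi> m (h None m \<omega>, \<lambda>n. h (Some n) m \<omega>, \<lambda>n. (Y n \<omega>, X n \<omega>)) \<partial>M)"
    unfolding mean_cell_capacity_def cell_capacity_def summand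
    by (rule nn_integral_suminf) (rule meas)
  also have "\<dots> = (\<Sum>m. \<integral>\<^sup>+\<omega>. \<integral>\<^sup>+t. \<integral>\<^sup>+\<eta>. \<Psi> m (t, \<eta>, \<lambda>n. (Y n \<omega>, X n \<omega>)) \<partial>Pi\<^sub>M UNIV (\<lambda>_. Q) \<partial>Q \<partial>M)"
    by (intro suminf_cong nn_integral_fading_given_locations[OF ind Q]) (auto simp: \<Psi>)
  also have "\<dots> = (\<Sum>m. \<integral>\<^sup>+\<omega>. \<integral>\<^sup>+t. \<phi> (inverse (t * L (- X m \<omega>))) *
      exp_minus (\<Sum>n. minus_log_compl (measure Q {t * L (- X m \<omega>) / L (Y n \<omega> - X m \<omega>)..})) \<partial>Q \<partial>M)"
    unfolding \<Psi>_def prod.case fst_conv snd_conv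
    by (intro suminf_cong nn_integral_cong Q.nn_integral_served_sum) auto
  finally show ?thesis .
qed

text \<open>
  Both averages over locations are taken here: Campbell's formula over the users and, for a fixed
  user position and a fixed fading, the Laplace functional over the stations.
\<close>

lemma (in prob_space) mean_cell_capacity_fading_intensity:
  fixes Y X :: "nat \<Rightarrow> 'a \<Rightarrow> 'b::euclidean_space"
  assumes "fading_law Q L"
    and Y: "homogeneous_poisson_process M lamB Y" and X: "homogeneous_poisson_process M lamM X"
    and lam: "0 \<le> lamB" "0 \<le> lamM" and YX: "independent_processes M Y X"
    and Q: "\<And>i m. distr M borel (h i m) = Q" and ind: "independent_fading M h Y X"
    and f: "capacity_function f"
  shows "mean_cell_capacity M L h Y X f = ennreal lamM *
    (\<integral>\<^sup>+\<beta>\<in>{0<..}. exp_minus (ennreal lamB * emeasure (fading_intensity Q L) {..\<beta>}) * ennreal (f \<beta>)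
      \<partial>fading_intensity Q L)"
proof -
  interpret Q: fading_law Q L by fact
  have Ym[measurable]: "Y n \<in> borel_measurable M" and Xm[measurable]: "X n \<in> borel_measurable M" for n
    using Y X by (simp_all add: homogeneous_poisson_process_def)
  define \<phi> where "\<phi> = (\<lambda>\<beta>. ennreal (f \<beta>) * indicator {0<..} \<beta>)"
  have \<phi>[measurable]: "\<phi> \<in> borel_measurable borel"
    unfolding \<phi>_def by (rule capacity_function_measurable[OF f])
  have [measurable]: "(\<lambda>a. measure Q {a..}) \<in> borel_measurable borel"
    by (rule measure_atLeast_measurable) (auto simp: Q.sets_Q Q.finite_measure_axioms)
  let ?F = "count_algebra M Y" and ?G = "locally_finite_event M Y"
  have AE_G: "AE \<omega> in M. \<omega> \<in> ?G" by (rule AE_locally_finite_event[OF Y lam(1)])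
  \<comment> \<open>The exponent \<open>w(y)\<close>, jointly measurable in the user position, the fading and the station position.\<close>
  define W where "W = (\<lambda>((x, t), y). minus_log_compl (measure Q {t * L (- x) / L (y - x)..}))"
  have W[measurable]: "W \<in> borel_measurable ((borel \<Otimes>\<^sub>M Q) \<Otimes>\<^sub>M borel)"
    unfolding W_def split_beta' by measurable
  \<comment> \<open>The indicator makes \<open>V\<close> measurable for the algebra of the counts; it is almost surely one.\<close>
  define V where "V \<omega> x t = exp_minus (indicator ?G \<omega> * (\<Sum>n. W ((x, t), Y n \<omega>)))" for \<omega> x t
  have "(\<lambda>(\<xi>, \<omega>). indicator ?G \<omega> * (\<Sum>n. W (\<xi>, Y n \<omega>))) \<in> borel_measurable ((borel \<Otimes>\<^sub>M Q) \<Otimes>\<^sub>M ?F)"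
    by (rule point_sum_measurable[OF W])
  note sum_measurable = this
  have "(\<lambda>z. ((fst (fst z), snd z), snd (fst z))) \<in> (borel \<Otimes>\<^sub>M ?F) \<Otimes>\<^sub>M Q \<rightarrow>\<^sub>M (borel \<Otimes>\<^sub>M Q) \<Otimes>\<^sub>M ?F"
    by measurable
  from measurable_compose[OF measurable_compose[OF this sum_measurable] exp_minus_measurable]
  have V: "(\<lambda>z. V (snd (fst z)) (fst (fst z)) (snd z)) \<in> borel_measurable ((borel \<Otimes>\<^sub>M ?F) \<Otimes>\<^sub>M Q)"
    by (simp add: V_def)
  define Z where "Z = (\<lambda>(x, \<omega>). \<integral>\<^sup>+t. \<phi> (inverse (t * L (- x))) * V \<omega> x t \<partial>Q)"
  have Z: "Z \<in> borel_measurable (borel \<Otimes>\<^sub>M ?F)"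
    unfolding Z_def split_beta' by (rule Q.borel_measurable_nn_integral) (use V in \<open>simp add: split_beta'\<close>)
  have V_AE: "AE \<omega> in M. \<forall>x t. V \<omega> x t =
      exp_minus (\<Sum>n. minus_log_compl (measure Q {t * L (- x) / L (Y n \<omega> - x)..}))"
    using AE_G by eventually_elim (simp add: V_def W_def)
  have Zx: "(\<integral>\<^sup>+\<omega>. Z (x, \<omega>) \<partial>M) = (\<integral>\<^sup>+t. \<phi> (inverse (t * L (- x))) *
      exp_minus (ennreal lamB * emeasure Q.\<mu> {..inverse (t * L (- x))}) \<partial>Q)" for x
  proof -
    interpret pair_sigma_finite M Q ..
    have "(\<lambda>z. ((x, fst z), snd z)) \<in> M \<Otimes>\<^sub>M Q \<rightarrow>\<^sub>M (borel \<Otimes>\<^sub>M ?F) \<Otimes>\<^sub>M Q"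
      by (intro measurable_Pair measurable_const measurable_snd
          measurable_compose[OF measurable_fst count_algebra_subalgebra[of Y M, OF Ym]]) auto
    from measurable_compose[OF this V]
    have Vx[measurable]: "(\<lambda>z. V (fst z) x (snd z)) \<in> borel_measurable (M \<Otimes>\<^sub>M Q)" by simp
    have "(\<integral>\<^sup>+\<omega>. Z (x, \<omega>) \<partial>M) = (\<integral>\<^sup>+t. \<integral>\<^sup>+\<omega>. \<phi> (inverse (t * L (- x))) * V \<omega> x t \<partial>M \<partial>Q)"
      unfolding Z_def prod.case by (rule Fubini'[symmetric]) (simp add: split_beta')
    also have "\<dots> = (\<integral>\<^sup>+t. \<phi> (inverse (t * L (- x))) *
      exp_minus (ennreal lamB * emeasure Q.\<mu> {..inverse (t * L (- x))}) \<partial>Q)"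
    proof (rule nn_integral_cong_AE, use Q.AE_Q_pos in eventually_elim)
      case (elim t)
      have "(\<lambda>\<omega>. (\<omega>, t)) \<in> M \<rightarrow>\<^sub>M M \<Otimes>\<^sub>M Q" by (intro measurable_Pair2') simp
      from measurable_compose[OF this Vx] have Vt: "(\<lambda>\<omega>. V \<omega> x t) \<in> borel_measurable M" by simp
      have "(\<integral>\<^sup>+\<omega>. V \<omega> x t \<partial>M) =
          (\<integral>\<^sup>+\<omega>. exp_minus (\<Sum>n. minus_log_compl (measure Q {t * L (- x) / L (Y n \<omega> - x)..})) \<partial>M)"
        by (rule nn_integral_cong_AE, use V_AE in eventually_elim) simp
      also have "\<dots> = exp_minus (ennreal lamB *
          (\<integral>\<^sup>+y. 1 - exp_minus (minus_log_compl (measure Q {t * L (- x) / L (y - x)..})) \<partial>lborel))"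
        by (rule poisson_laplace_functional[OF Y lam(1), where W = "\<lambda>y. minus_log_compl (measure Q {t * L (- x) / L (y - x)..})"]) measurable
      also have "(\<lambda>y. 1 - exp_minus (minus_log_compl (measure Q {t * L (- x) / L (y - x)..}))) =
          (\<lambda>y. ennreal (measure Q {t * L (- x) / L (y - x)..}))"
        by (auto simp: fun_eq_iff exp_minus_minus_log_compl ennreal_minus simp flip: ennreal_1)
      finally show ?case
        using Vt elim by (simp add: nn_integral_cmult Q.nn_integral_shifted_ccdf)
    qed
    finally show ?thesis .
  qed
  note [measurable] = Q.fading_intensity_atMost_measurable
  define g where "g \<beta> = \<phi> \<beta> * exp_minus (ennreal lamB * emeasure Q.\<mu> {..\<beta>})" for \<beta>
  have g[measurable]: "g \<in> borel_measurable borel" unfolding g_def by measurable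
  have "mean_cell_capacity M L h Y X f = (\<Sum>m. \<integral>\<^sup>+\<omega>. Z (X m \<omega>, \<omega>) \<partial>M)"
    unfolding mean_cell_capacity_sum_over_users[OF \<open>fading_law Q L\<close> Ym Xm Q ind f] Z_def prod.case
  proof (intro suminf_cong nn_integral_cong_AE)
    show "AE \<omega> in M. (\<integral>\<^sup>+t. ennreal (f (inverse (t * L (- X m \<omega>)))) * indicator {0<..} (inverse (t * L (- X m \<omega>))) *
      exp_minus (\<Sum>n. minus_log_compl (measure Q {t * L (- X m \<omega>) / L (Y n \<omega> - X m \<omega>)..})) \<partial>Q) =
      (\<integral>\<^sup>+t. \<phi> (inverse (t * L (- X m \<omega>))) * V \<omega> (X m \<omega>) t \<partial>Q)" for m
      using V_AE by eventually_elim (simp add: \<phi>_def)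
  qed
  also have "\<dots> = (\<integral>\<^sup>+\<omega>. (\<Sum>m. Z (X m \<omega>, \<omega>)) \<partial>M)"
  proof (rule nn_integral_suminf[symmetric])
    show "(\<lambda>\<omega>. Z (X m \<omega>, \<omega>)) \<in> borel_measurable M" for m
      by (rule measurable_compose[OF measurable_Pair[OF Xm count_algebra_subalgebra[of Y M, OF Ym]] Z])
  qed
  also have "\<dots> = ennreal lamM * (\<integral>\<^sup>+x. \<integral>\<^sup>+\<omega>. Z (x, \<omega>) \<partial>M \<partial>lborel)"
    by (rule campbell_independent[OF X lam(2) Ym YX Z])
  also have "(\<lambda>x. \<integral>\<^sup>+\<omega>. Z (x, \<omega>) \<partial>M) = (\<lambda>x. \<integral>\<^sup>+t. g (inverse (t * L (0 + (- 1) *\<^sub>R x))) \<partial>Q)"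
    by (simp add: Zx g_def)
  also have "(\<integral>\<^sup>+x. \<integral>\<^sup>+t. g (inverse (t * L (0 + (- 1) *\<^sub>R x))) \<partial>Q \<partial>lborel) =
      (\<integral>\<^sup>+x. \<integral>\<^sup>+t. g (inverse (t * L x)) \<partial>Q \<partial>lborel)"
    by (rule nn_integral_lborel_affine[of "\<lambda>x. \<integral>\<^sup>+t. g (inverse (t * L x)) \<partial>Q"]) auto
  also have "\<dots> = (\<integral>\<^sup>+\<beta>. g \<beta> \<partial>Q.\<mu>)" by (rule Q.nn_integral_fading_intensity[OF g, symmetric])
  also have "\<dots> = (\<integral>\<^sup>+\<beta>\<in>{0<..}. exp_minus (ennreal lamB * emeasure Q.\<mu> {..\<beta>}) * ennreal (f \<beta>) \<partial>Q.\<mu>)"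
    by (simp add: g_def \<phi>_def ac_simps)
  finally show ?thesis .
qed

section \<open>Fading with a density and path loss exponents\<close>

lemma fading_law_distr:
  fixes H :: "'w \<Rightarrow> real" and L :: "'a::euclidean_space \<Rightarrow> real"
  assumes "prob_space M" and dens: "distributed M lborel H p" and nonneg: "AE \<omega> in M. 0 \<le> H \<omega>"
    and L: "L \<in> borel_measurable borel" "\<And>z. 0 < L z"
  shows "fading_law (distr M borel H) L"
proof -
  interpret prob_space M by fact
  let ?Q = "distr M borel H"
  have H[measurable]: "H \<in> borel_measurable M" using distributed_measurable[OF dens] by simp
  interpret Q: prob_space ?Q by (rule prob_space_distr[OF H])
  have "?Q = density lborel p"
    using distributed_distr_eq_density[OF dens] by (simp cong: distr_cong)
  then have ac: "absolutely_continuous lborel ?Q"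
    using absolutely_continuousI_density[OF distributed_borel_measurable[OF dens]] by simp
  have "emeasure ?Q {..0} = emeasure ?Q {0}"
  proof (rule emeasure_eq_AE)
    have "AE t in ?Q. 0 \<le> t" using nonneg by (simp add: AE_distr_iff)
    then show "AE t in ?Q. t \<in> {..0} \<longleftrightarrow> t \<in> {0}" by eventually_elim auto
  qed auto
  moreover have "{0 :: real} \<in> null_sets lborel" by (simp add: null_sets_def)
  ultimately have "emeasure ?Q {..0} = 0" using ac by (auto simp: absolutely_continuous_def)
  with ac L show ?thesis by unfold_locales auto
qed

lemma powr_le_powr_iff:
  fixes x y a :: real
  assumes "0 < a" "0 \<le> x" "0 \<le> y"
  shows "x powr a \<le> y powr a \<longleftrightarrow> x \<le> y"
  using assms powr_mono2[of a x y] powr_less_mono2[of a y x] by (auto simp: not_le[symmetric])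

text \<open>
  After exchanging the integrals, the positions with path loss fading at most \<open>\<beta>\<close> for a given
  fading \<open>t\<close> form a disc of radius \<open>(\<beta> K t)\<^bsup>1/\<gamma>\<^esup>\<close>, up to the origin, where \<open>L\<close> is arbitrary.
\<close>

lemma fading_intensity_path_loss_exponent:
  fixes L :: "real ^ 2 \<Rightarrow> real"
  assumes "fading_law Q L" and K: "0 < K" and \<gamma>: "0 < \<gamma>"
    and L: "\<And>z. z \<noteq> 0 \<Longrightarrow> L z = K * norm z powr (- \<gamma>)"
    and \<beta>: "0 < \<beta>"
  shows "emeasure (fading_intensity Q L) {..\<beta>} =
    ennreal (pi * K powr (2 / \<gamma>) * \<beta> powr (2 / \<gamma>)) * (\<integral>\<^sup>+t. ennreal (t powr (2 / \<gamma>)) \<partial>Q)"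
proof -
  interpret fading_law Q L by fact
  interpret pair_sigma_finite lborel Q ..
  have "emeasure \<mu> {..\<beta>} = (\<integral>\<^sup>+\<beta>'. indicator {..\<beta>} \<beta>' \<partial>\<mu>)" by simp
  also have "\<dots> = (\<integral>\<^sup>+x. \<integral>\<^sup>+t. indicator {..\<beta>} (inverse (t * L x)) \<partial>Q \<partial>lborel)"
    by (rule nn_integral_fading_intensity) simp
  also have "\<dots> = (\<integral>\<^sup>+t. \<integral>\<^sup>+x. indicator {..\<beta>} (inverse (t * L x)) \<partial>lborel \<partial>Q)"
    by (rule Fubini'[symmetric]) measurable
  also have "\<dots> = (\<integral>\<^sup>+t. ennreal (pi * K powr (2 / \<gamma>) * \<beta> powr (2 / \<gamma>)) * ennreal (t powr (2 / \<gamma>)) \<partial>Q)"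
  proof (rule nn_integral_cong_AE, use AE_Q_pos in eventually_elim)
    case (elim t)
    define r where "r = (\<beta> * K * t) powr (1 / \<gamma>)"
    have r: "0 \<le> r" by (simp add: r_def)
    have *: "inverse (t * L x) \<le> \<beta> \<longleftrightarrow> norm x \<le> r" if "x \<noteq> 0" for x
    proof -
      have n: "0 < norm x" using that by simp
      define u where "u = norm x powr \<gamma>"
      have u: "0 < u" "L x = K / u" using n L[OF that] by (simp_all add: u_def powr_minus_divide)
      have "inverse (t * L x) \<le> \<beta> \<longleftrightarrow> norm x powr \<gamma> \<le> \<beta> * K * t"
        unfolding u(2) u_def[symmetric] using u(1) K \<beta> elim by (simp add: field_simps)
      also have "\<dots> \<longleftrightarrow> (norm x powr \<gamma>) powr (1 / \<gamma>) \<le> r"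
        unfolding r_def using \<gamma> K \<beta> elim by (intro powr_le_powr_iff[symmetric]) auto
      also have "(norm x powr \<gamma>) powr (1 / \<gamma>) = norm x" using n \<gamma> by (simp add: powr_powr)
      finally show ?thesis .
    qed
    have "AE x in lborel. x \<noteq> (0 :: real ^ 2)" by (rule AE_lborel_singleton)
    then have "(\<integral>\<^sup>+x. indicator {..\<beta>} (inverse (t * L x)) \<partial>lborel) =
        (\<integral>\<^sup>+x. indicator (cball 0 r) x \<partial>(lborel :: (real ^ 2) measure))"
      by (intro nn_integral_cong_AE, eventually_elim) (auto simp: indicator_def * simp del: inverse_mult_distrib)
    also have "\<dots> = ennreal (pi * r ^ 2)"
      using r by (simp add: emeasure_cball unit_ball_vol_2)
    also have "r ^ 2 = K powr (2 / \<gamma>) * \<beta> powr (2 / \<gamma>) * t powr (2 / \<gamma>)"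
      using K \<beta> elim by (simp add: r_def powr_mult power_mult_distrib powr_power)
    finally show ?case by (simp add: mult.assoc flip: ennreal_mult)
  qed
  also have "\<dots> = ennreal (pi * K powr (2 / \<gamma>) * \<beta> powr (2 / \<gamma>)) * (\<integral>\<^sup>+t. ennreal (t powr (2 / \<gamma>)) \<partial>Q)"
    by (rule nn_integral_cmult) measurable
  finally show ?thesis .
qed

text \<open>
  The substitution \<open>\<beta> = t\<^bsup>\<gamma>/2\<^esup>\<close>, obtained by comparing distribution functions: \<open>\<nu>\<close> is the image of
  \<open>C\<close> times Lebesgue measure on the half-line.
\<close>

lemma nn_integral_power_law_measure:
  fixes \<mu> :: "real measure" and g :: "real \<Rightarrow> ennreal"
  assumes \<mu>: "sets \<mu> = sets borel" and null: "emeasure \<mu> {..0} = 0"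
    and C: "0 \<le> C" and \<gamma>: "0 < \<gamma>"
    and \<mu>_atMost: "\<And>\<beta>. 0 < \<beta> \<Longrightarrow> emeasure \<mu> {..\<beta>} = ennreal (C * \<beta> powr (2 / \<gamma>))"
    and g[measurable]: "g \<in> borel_measurable borel"
  shows "(\<integral>\<^sup>+\<beta>. g \<beta> \<partial>\<mu>) = ennreal C * (\<integral>\<^sup>+t\<in>{0<..}. g (t powr (\<gamma> / 2)) \<partial>lborel)"
proof -
  define \<rho> :: "real measure" where "\<rho> = density lborel (\<lambda>t. ennreal C * indicator {0<..} t)"
  have [measurable_cong]: "sets \<rho> = sets borel" by (simp add: \<rho>_def)
  define \<nu> where "\<nu> = distr \<rho> borel (\<lambda>t. t powr (\<gamma> / 2))"
  have [measurable]: "(\<lambda>t::real. t powr (\<gamma> / 2)) \<in> borel_measurable borel" by measurable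
  have \<nu>: "(\<integral>\<^sup>+\<beta>. g' \<beta> \<partial>\<nu>) = ennreal C * (\<integral>\<^sup>+t\<in>{0<..}. g' (t powr (\<gamma> / 2)) \<partial>lborel)"
    if [measurable]: "g' \<in> borel_measurable borel" for g' :: "real \<Rightarrow> ennreal"
  proof -
    have "(\<integral>\<^sup>+\<beta>. g' \<beta> \<partial>\<nu>) = (\<integral>\<^sup>+t. g' (t powr (\<gamma> / 2)) \<partial>\<rho>)"
      unfolding \<nu>_def by (rule nn_integral_distr) measurable
    also have "\<dots> = (\<integral>\<^sup>+t. ennreal C * (g' (t powr (\<gamma> / 2)) * indicator {0<..} t) \<partial>lborel)"
      unfolding \<rho>_def by (subst nn_integral_density) (auto simp: ac_simps)
    finally show ?thesis by (simp add: nn_integral_cmult)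
  qed
  have pos: "emeasure \<nu> {..\<beta>} = ennreal (C * \<beta> powr (2 / \<gamma>))" if \<beta>: "0 < \<beta>" for \<beta>
  proof -
    have *: "t powr (\<gamma> / 2) \<le> \<beta> \<longleftrightarrow> t \<le> \<beta> powr (2 / \<gamma>)" if "0 < t" for t
    proof -
      have "t powr (\<gamma> / 2) \<le> \<beta> \<longleftrightarrow> (t powr (\<gamma> / 2)) powr (2 / \<gamma>) \<le> \<beta> powr (2 / \<gamma>)"
        using \<beta> \<gamma> by (intro powr_le_powr_iff[symmetric]) auto
      then show ?thesis using that \<gamma> by (simp add: powr_powr)
    qed
    have "emeasure \<nu> {..\<beta>} = ennreal C * (\<integral>\<^sup>+t\<in>{0<..}. indicator {..\<beta>} (t powr (\<gamma> / 2)) \<partial>lborel)"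
      using \<nu>[of "indicator {..\<beta>}"] by (simp add: \<nu>_def)
    also have "(\<integral>\<^sup>+t\<in>{0<..}. indicator {..\<beta>} (t powr (\<gamma> / 2)) \<partial>lborel) =
        (\<integral>\<^sup>+t. indicator {0<..\<beta> powr (2 / \<gamma>)} t \<partial>lborel)"
      by (intro nn_integral_cong) (auto simp: indicator_def *)
    finally show ?thesis using C by (simp add: ennreal_mult)
  qed
  have npos: "emeasure \<mu> {..\<beta>} = 0" "emeasure \<nu> {..\<beta>} = 0" if "\<beta> \<le> 0" for \<beta>
  proof -
    have "emeasure \<mu> {..\<beta>} \<le> emeasure \<mu> {..0}" using that by (intro emeasure_mono) (auto simp: \<mu>)
    then show "emeasure \<mu> {..\<beta>} = 0" using null by simp
    have "(\<integral>\<^sup>+t\<in>{0<..}. indicator {..\<beta>} (t powr (\<gamma> / 2)) \<partial>lborel) = (\<integral>\<^sup>+t. 0 \<partial>(lborel :: real measure))"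
    proof (intro nn_integral_cong)
      fix t :: real
      have "\<not> t powr (\<gamma> / 2) \<le> \<beta>" if "0 < t"
        using \<open>\<beta> \<le> 0\<close> that by (metis not_le order_less_le_trans powr_gt_zero less_irrefl)
      then show "indicator {..\<beta>} (t powr (\<gamma> / 2)) * indicator {0<..} t = (0 :: ennreal)"
        by (auto simp: indicator_def)
    qed
    then show "emeasure \<nu> {..\<beta>} = 0" using \<nu>[of "indicator {..\<beta>}"] by (simp add: \<nu>_def)
  qed
  have "\<mu> = \<nu>"
  proof (rule borel_measure_eqI_atMost[OF \<mu>])
    show "emeasure \<mu> {..b} = emeasure \<nu> {..b}" "emeasure \<mu> {..b} < \<infinity>" for b
      by (cases "0 < b"; simp add: npos \<mu>_atMost pos)+
  qed (simp add: \<nu>_def)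
  then show ?thesis by (simp add: \<nu>)
qed

theorem theorem5:
  fixes M :: "'w measure"
    and Y X :: "nat \<Rightarrow> 'w \<Rightarrow> real ^ 2"
    and h :: "nat option \<Rightarrow> nat \<Rightarrow> 'w \<Rightarrow> real"
    and H :: "'w \<Rightarrow> real"
    and p\<^sub>H :: "real \<Rightarrow> real"
    and L :: "real ^ 2 \<Rightarrow> real"
    and lam\<^sub>B lam\<^sub>M :: real
    and f :: "real \<Rightarrow> real"
  assumes "prob_space M"
    and "0 < lam\<^sub>B" and "0 < lam\<^sub>M"
    and "homogeneous_poisson_process M lam\<^sub>B Y"
    and "homogeneous_poisson_process M lam\<^sub>M X"
    and "independent_processes M Y X"
    and "L \<in> borel_measurable borel" and "\<And>z. 0 < L z"
    and "\<And>t. 0 \<le> p\<^sub>H t"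
    and "distributed M lborel H (\<lambda>t. ennreal (p\<^sub>H t))"
    and "AE \<omega> in M. 0 \<le> H \<omega>"
    and "\<And>\<beta>. 0 < ccdf M H \<beta>"
    and "\<And>i m. distr M borel (h i m) = distr M borel H"
    and "independent_fading M h Y X"
    and "\<And>\<beta>. 0 < \<beta> \<Longrightarrow> integrable lborel (\<lambda>z. ccdf M H (inverse (L z * \<beta>)))"
    and "\<And>\<beta>. 0 < \<beta> \<Longrightarrow> 0 < B_fun M L H \<beta>"
    and "capacity_function f"
  shows "mean_cell_capacity M L h Y X f =
      ennreal lam\<^sub>M * (\<integral>\<^sup>+\<beta>\<in>{0<..}.
        ennreal (deriv (B_fun M L H) \<beta> * exp (- (lam\<^sub>B * B_fun M L H \<beta>)) * f \<beta>) \<partial>lborel) \<and>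
    (\<forall>K \<gamma> C. 0 < K \<longrightarrow> 0 < \<gamma> \<longrightarrow> (\<forall>z. z \<noteq> 0 \<longrightarrow> L z = K * norm z powr (- \<gamma>)) \<longrightarrow>
      C = pi * K powr (2 / \<gamma>) * (\<integral>\<omega>. H \<omega> powr (2 / \<gamma>) \<partial>M) \<longrightarrow>
      mean_cell_capacity M L h Y X f =
        ennreal (lam\<^sub>M / lam\<^sub>B) *
          (ennreal (lam\<^sub>B * C) * laplace_transform (\<lambda>t. f (t powr (\<gamma> / 2))) (lam\<^sub>B * C)))"
proof -
  note lam = assms(2,3) and integrable = assms(15) and B_pos = assms(16) and f = assms(17)
  interpret prob_space M by fact
  have H[measurable]: "H \<in> borel_measurable M"
    using distributed_measurable[OF assms(10)] by simp
  let ?Q = "distr M borel H" and ?B = "B_fun M L H"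
  have law: "fading_law ?Q L" using assms by (intro fading_law_distr)
  interpret Q: fading_law ?Q L by (rule law)
  have ccdf: "ccdf M H b = measure ?Q {b..}" for b
    by (auto simp: ccdf_def measure_distr intro!: arg_cong[of _ _ "measure M"])
  have \<mu>_atMost: "emeasure Q.\<mu> {..\<beta>} = ennreal (?B \<beta>)" if "0 < \<beta>" for \<beta>
    using Q.fading_intensity_atMost[OF that] integrable[OF that]
    by (simp add: B_fun_def ccdf nn_integral_eq_integral)
  define g where "g \<beta> = exp_minus (ennreal lam\<^sub>B * emeasure Q.\<mu> {..\<beta>}) * ennreal (f \<beta>) * indicator {0<..} \<beta>" for \<beta>
  note [measurable] = Q.fading_intensity_atMost_measurable
  have g[measurable]: "g \<in> borel_measurable borel" unfolding g_def mult.assoc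
    by (rule borel_measurable_times_ennreal[OF _ capacity_function_measurable[OF f]]) measurable
  have g_eq: "g \<beta> = ennreal (exp (- (lam\<^sub>B * ?B \<beta>)) * f \<beta>)" if "0 < \<beta>" for \<beta>
  proof -
    have "exp_minus (ennreal lam\<^sub>B * emeasure Q.\<mu> {..\<beta>}) = exp_minus (ennreal (lam\<^sub>B * ?B \<beta>))"
      using lam B_pos[OF that] by (simp add: \<mu>_atMost[OF that] ennreal_mult)
    also have "\<dots> = ennreal (exp (- (lam\<^sub>B * ?B \<beta>)))"
      using lam B_pos[OF that] by (intro exp_minus_ennreal) simp
    finally show ?thesis using that by (simp add: g_def ennreal_mult')
  qed
  have mean: "mean_cell_capacity M L h Y X f = ennreal lam\<^sub>M * (\<integral>\<^sup>+\<beta>. g \<beta> \<partial>Q.\<mu>)"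
    unfolding g_def using assms lam by (intro mean_cell_capacity_fading_intensity[OF law]) auto
  show ?thesis
  proof (intro conjI allI impI)
    have "(\<integral>\<^sup>+\<beta>. g \<beta> \<partial>Q.\<mu>) = (\<integral>\<^sup>+\<beta>\<in>{0<..}. ennreal (deriv ?B \<beta>) * g \<beta> \<partial>lborel)"
      using B_pos by (intro nn_integral_abs_continuous_eq_deriv Q.absolutely_continuous_fading_intensity
        Q.fading_intensity_nonpos \<mu>_atMost) (auto intro: less_imp_le)
    also have "\<dots> = (\<integral>\<^sup>+\<beta>\<in>{0<..}. ennreal (deriv ?B \<beta> * exp (- (lam\<^sub>B * ?B \<beta>)) * f \<beta>) \<partial>lborel)"
      using f by (intro nn_integral_cong)
        (auto simp: g_eq capacity_function_def mult.assoc ennreal_mult'' indicator_def)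
    finally show "mean_cell_capacity M L h Y X f = ennreal lam\<^sub>M * (\<integral>\<^sup>+\<beta>\<in>{0<..}.
        ennreal (deriv ?B \<beta> * exp (- (lam\<^sub>B * ?B \<beta>)) * f \<beta>) \<partial>lborel)"
      unfolding mean by simp
  next
    fix K \<gamma> C :: real
    assume K: "0 < K" and \<gamma>: "0 < \<gamma>" and L: "\<forall>z. z \<noteq> 0 \<longrightarrow> L z = K * norm z powr (- \<gamma>)"
      and C: "C = pi * K powr (2 / \<gamma>) * (\<integral>\<omega>. H \<omega> powr (2 / \<gamma>) \<partial>M)"
    let ?E = "\<integral>\<^sup>+\<omega>. ennreal (H \<omega> powr (2 / \<gamma>)) \<partial>M"
    have \<mu>_E: "emeasure Q.\<mu> {..\<beta>} = ennreal (pi * K powr (2 / \<gamma>) * \<beta> powr (2 / \<gamma>)) * ?E" if "0 < \<beta>" for \<beta>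
      using fading_intensity_path_loss_exponent[OF law K \<gamma> _ that] L by (simp add: nn_integral_distr)
    \<comment> \<open>The moment of order \<open>2 / \<gamma>\<close> is finite because \<open>B(1)\<close> is.\<close>
    have "?E \<noteq> \<infinity>"
      using \<mu>_E[of 1] \<mu>_atMost[of 1] K by (auto simp: ennreal_mult_eq_top_iff)
    then have "integrable M (\<lambda>\<omega>. H \<omega> powr (2 / \<gamma>))"
      by (intro integrableI_nonneg) (auto simp: less_top)
    then have "?E = ennreal (\<integral>\<omega>. H \<omega> powr (2 / \<gamma>) \<partial>M)" by (intro nn_integral_eq_integral) auto
    then have \<mu>_C: "emeasure Q.\<mu> {..\<beta>} = ennreal (C * \<beta> powr (2 / \<gamma>))" if "0 < \<beta>" for \<beta>
      using \<mu>_E[OF that] by (simp add: C ac_simps flip: ennreal_mult)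
    have B_C: "?B \<beta> = C * \<beta> powr (2 / \<gamma>)" if "0 < \<beta>" for \<beta>
      using \<mu>_C[OF that] \<mu>_atMost[OF that] B_pos[OF that]
      by (metis ennreal_eq_0_iff ennreal_inj less_imp_le linorder_not_le)
    have C_pos: "0 < C" using B_C[of 1] B_pos[of 1] by simp
    have "(\<integral>\<^sup>+\<beta>. g \<beta> \<partial>Q.\<mu>) = ennreal C * (\<integral>\<^sup>+t\<in>{0<..}. g (t powr (\<gamma> / 2)) \<partial>lborel)"
      using C_pos by (intro nn_integral_power_law_measure[OF _ Q.fading_intensity_nonpos _ \<gamma> \<mu>_C]) auto
    also have "(\<integral>\<^sup>+t\<in>{0<..}. g (t powr (\<gamma> / 2)) \<partial>lborel) =
        laplace_transform (\<lambda>t. f (t powr (\<gamma> / 2))) (lam\<^sub>B * C)"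
      unfolding laplace_transform_def
    proof (intro nn_integral_cong)
      fix t :: real
      have "g (t powr (\<gamma> / 2)) = ennreal (exp (- (lam\<^sub>B * C * t)) * f (t powr (\<gamma> / 2)))" if "0 < t"
        using that \<gamma> by (simp add: g_eq B_C powr_powr mult.assoc)
      then show "g (t powr (\<gamma> / 2)) * indicator {0<..} t =
          ennreal (exp (- (lam\<^sub>B * C * t)) * f (t powr (\<gamma> / 2))) * indicator {0<..} t"
        by (auto simp: indicator_def)
    qed
    finally show "mean_cell_capacity M L h Y X f = ennreal (lam\<^sub>M / lam\<^sub>B) *
          (ennreal (lam\<^sub>B * C) * laplace_transform (\<lambda>t. f (t powr (\<gamma> / 2))) (lam\<^sub>B * C))"
      using lam C_pos by (simp add: mean mult.assoc[symmetric] flip: ennreal_mult)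
  qed
qed

end
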